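(* Let $(V,E)$ be a decomposable lattice-normed space and let $(W,F)$ be a Banach-Kantorovich space with $F$ Dedekind complete. Then a dominated Uryson operator $T:V\to W$ is completely additive if and only if its exact dominant $\|T\|:E\to F$ is completely additive.
   Context: Lattice-normed spaces. Let $V$ be a real vector space and $E$ a real Archimedean vector lattice. A vector norm is a map $\|\cdot\|:V\to E$ with $\|v\|\ge 0$, $\|v\|=0\Leftrightarrow v=0$, $\|v_1+v_2\|\le\|v_1\|+\|v_2\|$, $\|\lambda v\|=|\lambda|\,\|v\|$ ($\lambda\in\mathbb{R}$). $(V,E)$ is then a lattice-normed space. It is decomposable if whenever $\|x\|=e_1+e_2$ with $e_1,e_2\in E_+$ there are $x_1,x_2\in V$ with $x=x_1+x_2$ and $\|x_k\|=e_k$ ($k=1,2$). Elements $x,y\in V$ are disjoint, $x\perp y$, if $\|x\|\wedge\|y\|=0$. A net $(v_\alpha)$ in $V$ $(bo)$-converges to $v\in V$ if there is a decreasing net $(e_\gamma)_{\gamma\in\Gamma}$ in $E$ with $\inf_\gamma e_\gamma=0$ such that for every $\gamma$ there is an index $\alpha(\gamma)$ with $\|v-v_\alpha\|\le e_\gamma$ for all $\alpha\ge\alpha(\gamma)$. A net $(v_\alpha)$ is $(bo)$-fundamental if the net $(v_\alpha-v_\beta)_{(\alpha,\beta)}$ $(bo)$-converges to $0$; $V$ is $(bo)$-complete if every $(bo)$-fundamental net $(bo)$-converges. A Banach-Kantorovich space is a decomposable $(bo)$-complete lattice-normed space. A vector lattice $E$ is regarded as the lattice-normed space $(E,E)$ with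 norm $|\cdot|$. Operators. A map $S:E\to F$ between vector lattices is orthogonally additive if $S(x+y)=Sx+Sy$ whenever $|x|\wedge|y|=0$; positive if $Sx\ge0$ for all $x\in E$; order bounded if it maps order bounded sets to order bounded sets; even if $S(x)=S(-x)$ for all $x$. An abstract Uryson operator is an orthogonally additive order bounded map. $\mathcal{U}_+^{ev}(E,F)$ is the set of positive even abstract Uryson operators, ordered by $S_1\le S_2$ iff $S_2-S_1$ is positive. A map $T:V\to W$ is orthogonally additive if $T(u+v)=Tu+Tv$ whenever $u\perp v$ in $V$. It is a dominated Uryson operator if it is orthogonally additive and there is $S\in\mathcal{U}_+^{ev}(E,F)$ (a dominant of $T$) with $\|Tv\|\le S\|v\|$ for all $v\in V$. The exact dominant $\|T\|$ is the least dominant of $T$ in $\mathcal{U}_+^{ev}(E,F)$; it exists when $V$ is decomposable and $F$ is Dedekind complete. Complete additivity. A family $(v_\alpha)_{\alpha\in\Lambda}$ in a lattice-normed space is $(bo)$-summable if the net of finite partial sums $w_\theta=\sum_{\alpha\in\theta}v_\alpha$, indexed by the finite subsets $\theta\subset\Lambda$ ordered by inclusion, is $(bo)$-convergent; its limit is denoted $bo\text{-}\sum_\alpha v_\alpha$. An orthogonally additive operator $T:V\to W$ is completely additive if for every $(bo)$-summable family $(v_\alpha)$ of mutually disjoint elements of $V$ the family $(Tv_\alpha)$ is $(bo)$-summable and $T(bo\text{-}\sum_\alpha v_\alpha)=bo\text{-}\sum_\alpha Tv_\alpha$. *)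

theory Defs
  imports Complex_Main "HOL-Library.Lattice_Algebras" "HOL-Library.Lub_Glb"
begin

subsection \<open>Archimedean vector lattices\<close>

class archimedean_vector_lattice = ordered_real_vector + lattice_ab_group_add_abs +
  assumes archimedean: "(\<And>n::nat. real n *\<^sub>R x \<le> y) \<Longrightarrow> x \<le> 0"

text \<open>
  Dedekind completeness is expressed by additionally requiring the class
  \<^class>\<open>conditionally_complete_lattice\<close>.
\<close>

lemma isGlb_UNIV_iff:
  "isGlb UNIV S (x::'a::order) \<longleftrightarrow> (\<forall>y\<in>S. x \<le> y) \<and> (\<forall>l. (\<forall>y\<in>S. l \<le> y) \<longrightarrow> l \<le> x)"
  by (auto simp: isGlb_def greatestP_def isLb_def setge_def setle_def)


subsection \<open>Lattice-normed spaces\<close>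

locale lattice_normed_space =
  fixes nrm :: "'v::real_vector \<Rightarrow> 'e::archimedean_vector_lattice"
  assumes nrm_nonneg: "0 \<le> nrm v"
    and nrm_eq_0_iff: "nrm v = 0 \<longleftrightarrow> v = 0"
    and nrm_triangle: "nrm (v + w) \<le> nrm v + nrm w"
    and nrm_scaleR: "nrm (c *\<^sub>R v) = \<bar>c\<bar> *\<^sub>R nrm v"

definition decomposable :: "('v::real_vector \<Rightarrow> 'e::archimedean_vector_lattice) \<Rightarrow> bool" where
  "decomposable nrm \<longleftrightarrow>
    (\<forall>x e1 e2. 0 \<le> e1 \<longrightarrow> 0 \<le> e2 \<longrightarrow> nrm x = e1 + e2 \<longrightarrow>
      (\<exists>x1 x2. x = x1 + x2 \<and> nrm x1 = e1 \<and> nrm x2 = e2))"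

definition disjoint_elts ::
  "('v::real_vector \<Rightarrow> 'e::archimedean_vector_lattice) \<Rightarrow> 'v \<Rightarrow> 'v \<Rightarrow> bool" where
  "disjoint_elts nrm x y \<longleftrightarrow> inf (nrm x) (nrm y) = 0"


subsection \<open>Order convergence of nets\<close>

text \<open>A net is a function on a set \<open>A\<close> directed by a relation \<open>le\<close>.\<close>

definition directed_set :: "'i set \<Rightarrow> ('i \<Rightarrow> 'i \<Rightarrow> bool) \<Rightarrow> bool" where
  "directed_set A le \<longleftrightarrow>
    A \<noteq> {} \<and> reflp_on A le \<and> transp_on A le \<and> (\<forall>a\<in>A. \<forall>b\<in>A. \<exists>c\<in>A. le a c \<and> le b c)"

definition decreasing_to_0 ::
  "'g set \<Rightarrow> ('g \<Rightarrow> 'g \<Rightarrow> bool) \<Rightarrow> ('g \<Rightarrow> 'e::archimedean_vector_lattice) \<Rightarrow> bool" where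
  "decreasing_to_0 G le e \<longleftrightarrow>
    directed_set G le \<and> (\<forall>\<gamma>\<in>G. \<forall>\<delta>\<in>G. le \<gamma> \<delta> \<longrightarrow> e \<delta> \<le> e \<gamma>) \<and> isGlb UNIV (e ` G) 0"

text \<open>
  HOL cannot quantify over the type of the index set of the dominating net, so it is
  taken inside the type \<open>'e\<close> of its values. By \<open>bo_converges_toI\<close> below this
  is no restriction: a decreasing net can be reindexed by its range.
\<close>

definition bo_converges_to ::
  "('v::real_vector \<Rightarrow> 'e::archimedean_vector_lattice) \<Rightarrow>
    'i set \<Rightarrow> ('i \<Rightarrow> 'i \<Rightarrow> bool) \<Rightarrow> ('i \<Rightarrow> 'v) \<Rightarrow> 'v \<Rightarrow> bool" where
  "bo_converges_to nrm A le v x \<longleftrightarrow>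
    (\<exists>(G::'e set) leG e. decreasing_to_0 G leG e \<and>
      (\<forall>\<gamma>\<in>G. \<exists>a\<in>A. \<forall>b\<in>A. le a b \<longrightarrow> nrm (x - v b) \<le> e \<gamma>))"

lemma bo_converges_toI:
  fixes G :: "'g set"
  assumes G: "decreasing_to_0 G leG e"
    and ev: "\<And>\<gamma>. \<gamma> \<in> G \<Longrightarrow> \<exists>a\<in>A. \<forall>b\<in>A. le a b \<longrightarrow> nrm (x - v b) \<le> e \<gamma>"
  shows "bo_converges_to nrm A le v x"
proof -
  have ne: "G \<noteq> {}" and ub: "\<forall>a\<in>G. \<forall>b\<in>G. \<exists>c\<in>G. leG a c \<and> leG b c"
    and mono: "\<forall>\<gamma>\<in>G. \<forall>\<delta>\<in>G. leG \<gamma> \<delta> \<longrightarrow> e \<delta> \<le> e \<gamma>" and glb: "isGlb UNIV (e ` G) 0"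
    using G unfolding decreasing_to_0_def directed_set_def by simp_all
  have ub': "\<exists>c\<in>e ` G. c \<le> x \<and> c \<le> y" if xy: "x \<in> e ` G" "y \<in> e ` G" for x y
  proof -
    obtain a b where ab: "a \<in> G" "b \<in> G" "x = e a" "y = e b"
      using xy by (elim imageE) (rule that)
    then obtain c where "c \<in> G" "leG a c" "leG b c" using ub by blast
    then show ?thesis using ab mono by (intro bexI[of _ "e c"]) auto
  qed
  have "directed_set (e ` G) (\<lambda>a b. b \<le> a)"
    unfolding directed_set_def
    by (intro conjI reflp_onI transp_onI ballI ub') (use ne in auto)
  then have "decreasing_to_0 (e ` G) (\<lambda>a b. b \<le> a) (\<lambda>a. a)"
    using glb unfolding decreasing_to_0_def by simp
  moreover have "\<forall>\<gamma>\<in>e ` G. \<exists>a\<in>A. \<forall>b\<in>A. le a b \<longrightarrow> nrm (x - v b) \<le> \<gamma>"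
    using ev by simp
  ultimately show ?thesis
    unfolding bo_converges_to_def by (intro exI conjI)
qed

definition bo_fundamental ::
  "('v::real_vector \<Rightarrow> 'e::archimedean_vector_lattice) \<Rightarrow>
    'i set \<Rightarrow> ('i \<Rightarrow> 'i \<Rightarrow> bool) \<Rightarrow> ('i \<Rightarrow> 'v) \<Rightarrow> bool" where
  "bo_fundamental nrm A le v \<longleftrightarrow>
    bo_converges_to nrm (A \<times> A) (\<lambda>(a, b) (a', b'). le a a' \<and> le b b') (\<lambda>(a, b). v a - v b) 0"

text \<open>
  Again index sets are taken inside the type \<open>'e\<close>; by \<open>bo_completeD\<close> below,
  fundamental nets over index sets of arbitrary type then converge as well.
\<close>

definition bo_complete :: "('v::real_vector \<Rightarrow> 'e::archimedean_vector_lattice) \<Rightarrow> bool" where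
  "bo_complete nrm \<longleftrightarrow>
    (\<forall>(A::'e set) le v. directed_set A le \<longrightarrow> bo_fundamental nrm A le v \<longrightarrow>
      (\<exists>x. bo_converges_to nrm A le v x))"

locale banach_kantorovich_space = lattice_normed_space +
  assumes decomposable: "decomposable nrm"
    and bo_complete: "bo_complete nrm"

context lattice_normed_space
begin

lemma nrm_minus_commute: "nrm (x - y) = nrm (y - x)"
  using nrm_scaleR[of "-1" "x - y"] by simp

lemma nrm_diff_triangle: "nrm (x - z) \<le> nrm (x - y) + nrm (y - z)"
  using nrm_triangle[of "x - y" "y - z"] by simp

lemma bo_completeD:
  fixes A :: "'i set"
  assumes compl: "bo_complete nrm" and dir: "directed_set A le"
    and fund: "bo_fundamental nrm A le v"
  shows "\<exists>x. bo_converges_to nrm A le v x"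
proof -
  obtain G :: "'e set" and leG e where G: "decreasing_to_0 G leG e"
    and ev: "\<forall>\<gamma>\<in>G. \<exists>p\<in>A \<times> A. \<forall>q\<in>A \<times> A.
        (\<lambda>(a, b) (a', b'). le a a' \<and> le b b') p q \<longrightarrow> nrm (0 - (\<lambda>(a, b). v a - v b) q) \<le> e \<gamma>"
    using fund unfolding bo_fundamental_def bo_converges_to_def by (elim exE conjE)
  have trans: "le a c" if "le a b" "le b c" "a \<in> A" "b \<in> A" "c \<in> A" for a b c
    using dir that unfolding directed_set_def transp_on_def by blast
  have ub: "\<exists>c\<in>A. le a c \<and> le b c" if "a \<in> A" "b \<in> A" for a b
    using dir that unfolding directed_set_def by blast
  have "\<exists>k\<in>A. \<forall>c\<in>A. \<forall>d\<in>A. le k c \<longrightarrow> le k d \<longrightarrow> nrm (v c - v d) \<le> e \<gamma>" if "\<gamma> \<in> G" for \<gamma>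
  proof -
    obtain a b where ab: "a \<in> A" "b \<in> A"
      and *: "\<And>c d. c \<in> A \<Longrightarrow> d \<in> A \<Longrightarrow> le a c \<Longrightarrow> le b d \<Longrightarrow> nrm (v d - v c) \<le> e \<gamma>"
      using bspec[OF ev \<open>\<gamma> \<in> G\<close>] by (auto simp: split_beta)
    obtain k where "k \<in> A" "le a k" "le b k" using ub ab by blast
    then show ?thesis using ab * trans by (metis nrm_minus_commute)
  qed
  then obtain k where kA: "\<And>\<gamma>. \<gamma> \<in> G \<Longrightarrow> k \<gamma> \<in> A"
    and k: "\<And>\<gamma> c d. \<gamma> \<in> G \<Longrightarrow> c \<in> A \<Longrightarrow> d \<in> A \<Longrightarrow> le (k \<gamma>) c \<Longrightarrow> le (k \<gamma>) d \<Longrightarrow>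
      nrm (v c - v d) \<le> e \<gamma>"
    by metis
  have dirG: "directed_set G leG" and mono: "\<And>\<gamma> \<delta>. \<gamma> \<in> G \<Longrightarrow> \<delta> \<in> G \<Longrightarrow> leG \<gamma> \<delta> \<Longrightarrow> e \<delta> \<le> e \<gamma>"
    and glb: "isGlb UNIV (e ` G) 0"
    using G unfolding decreasing_to_0_def by blast+
  have le0: "l \<le> 0" if "\<And>\<gamma>. \<gamma> \<in> G \<Longrightarrow> l \<le> e \<gamma>" for l
    using glb that unfolding isGlb_UNIV_iff by blast
  have e_nonneg: "0 \<le> e \<gamma>" if "\<gamma> \<in> G" for \<gamma>
    using glb that unfolding isGlb_UNIV_iff by blast
  have refl: "le a a" if "a \<in> A" for a
    using dir that unfolding directed_set_def reflp_on_def by blast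
  have w: "nrm (v (k \<gamma>) - v (k \<delta>)) \<le> e \<gamma> + e \<delta>" if gd: "\<gamma> \<in> G" "\<delta> \<in> G" for \<gamma> \<delta>
  proof -
    obtain c where c: "c \<in> A" "le (k \<gamma>) c" "le (k \<delta>) c" using ub kA gd by blast
    have "nrm (v (k \<gamma>) - v (k \<delta>)) \<le> nrm (v (k \<gamma>) - v c) + nrm (v c - v (k \<delta>))"
      by (rule nrm_diff_triangle)
    also have "\<dots> \<le> e \<gamma> + e \<delta>"
      using k kA c gd refl by (intro add_mono) auto
    finally show ?thesis .
  qed
  have "decreasing_to_0 G leG (\<lambda>\<gamma>. 2 *\<^sub>R e \<gamma>)"
    unfolding decreasing_to_0_def isGlb_UNIV_iff
  proof (intro conjI dirG ballI impI allI)
    fix l assume l: "\<forall>y\<in>(\<lambda>\<gamma>. 2 *\<^sub>R e \<gamma>) ` G. l \<le> y"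
    have "(1/2) *\<^sub>R l \<le> 0"
    proof (rule le0)
      fix \<gamma> assume "\<gamma> \<in> G"
      then have "(1/2) *\<^sub>R l \<le> (1/2) *\<^sub>R (2 *\<^sub>R e \<gamma>)" using l by (intro scaleR_left_mono) auto
      then show "(1/2) *\<^sub>R l \<le> e \<gamma>" by simp
    qed
    then have "2 *\<^sub>R ((1/2) *\<^sub>R l) \<le> 2 *\<^sub>R 0" by (intro scaleR_left_mono) auto
    then show "l \<le> 0" by simp
  qed (auto intro!: scaleR_left_mono scaleR_nonneg_nonneg mono e_nonneg)
  then have "bo_fundamental nrm G leG (\<lambda>\<gamma>. v (k \<gamma>))"
    unfolding bo_fundamental_def
  proof (rule bo_converges_toI)
    fix \<gamma> assume g: "\<gamma> \<in> G"
    have "nrm (0 - (v (k a) - v (k b))) \<le> 2 *\<^sub>R e \<gamma>" if "a \<in> G" "b \<in> G" "leG \<gamma> a" "leG \<gamma> b" for a b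
    proof -
      have "nrm (0 - (v (k a) - v (k b))) = nrm (v (k b) - v (k a))" by simp
      also have "\<dots> \<le> e b + e a" using w that by blast
      also have "\<dots> \<le> e \<gamma> + e \<gamma>" using mono g that by (intro add_mono) auto
      finally show ?thesis by (simp add: scaleR_2)
    qed
    then show "\<exists>a\<in>G \<times> G. \<forall>b\<in>G \<times> G. (case a of (a, b) \<Rightarrow> \<lambda>(a', b'). leG a a' \<and> leG b b') b \<longrightarrow>
        nrm (0 - (case b of (a, b) \<Rightarrow> v (k a) - v (k b))) \<le> 2 *\<^sub>R e \<gamma>"
      using g by (intro bexI[of _ "(\<gamma>, \<gamma>)"]) (simp_all add: split_beta)
  qed
  then obtain x where "bo_converges_to nrm G leG (\<lambda>\<gamma>. v (k \<gamma>)) x"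
    using compl dirG unfolding bo_complete_def by blast
  then obtain H :: "'e set" and leH f where H: "decreasing_to_0 H leH f"
    and evH: "\<And>\<delta>. \<delta> \<in> H \<Longrightarrow> \<exists>a\<in>G. \<forall>b\<in>G. leG a b \<longrightarrow> nrm (x - v (k b)) \<le> f \<delta>"
    unfolding bo_converges_to_def by blast
  have "decreasing_to_0 (G \<times> H) (\<lambda>(a, b) (a', b'). leG a a' \<and> leH b b') (\<lambda>(a, b). e a + f b)"
    unfolding decreasing_to_0_def
  proof (intro conjI)
    show "directed_set (G \<times> H) (\<lambda>(a, b) (a', b'). leG a a' \<and> leH b b')"
    proof -
      have GH: "directed_set G leG" "directed_set H leH"
        using G H unfolding decreasing_to_0_def by blast+
      have "\<exists>p\<in>G \<times> H. (leG a (fst p) \<and> leH b (snd p)) \<and> leG a' (fst p) \<and> leH b' (snd p)"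
        if ab: "a \<in> G" "a' \<in> G" "b \<in> H" "b' \<in> H" for a a' b b'
      proof -
        obtain c d where "c \<in> G" "leG a c" "leG a' c" "d \<in> H" "leH b d" "leH b' d"
          using GH ab unfolding directed_set_def by meson
        then show ?thesis by (intro bexI[of _ "(c, d)"]) simp_all
      qed
      then have ub': "\<forall>p\<in>G \<times> H. \<forall>q\<in>G \<times> H. \<exists>r\<in>G \<times> H.
          (leG (fst p) (fst r) \<and> leH (snd p) (snd r)) \<and> leG (fst q) (fst r) \<and> leH (snd q) (snd r)"
        by (metis mem_Times_iff)
      have ne: "G \<times> H \<noteq> {}" and rG: "reflp_on G leG" and rH: "reflp_on H leH"
        and tG: "transp_on G leG" and tH: "transp_on H leH"
        using GH unfolding directed_set_def by blast+
      have "transp_on (G \<times> H) (\<lambda>p q. leG (fst p) (fst q) \<and> leH (snd p) (snd q))"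
      proof (rule transp_onI)
        fix p q r
        assume m: "p \<in> G \<times> H" "q \<in> G \<times> H" "r \<in> G \<times> H"
          and pq: "leG (fst p) (fst q) \<and> leH (snd p) (snd q)"
          and qr: "leG (fst q) (fst r) \<and> leH (snd q) (snd r)"
        have "leG (fst p) (fst r)" by (rule transp_onD[OF tG, of _ "fst q"]) (use m pq qr in auto)
        moreover have "leH (snd p) (snd r)" by (rule transp_onD[OF tH, of _ "snd q"]) (use m pq qr in auto)
        ultimately show "leG (fst p) (fst r) \<and> leH (snd p) (snd r)" by blast
      qed
      moreover have "reflp_on (G \<times> H) (\<lambda>p q. leG (fst p) (fst q) \<and> leH (snd p) (snd q))"
        using rG rH by (simp add: reflp_on_def)
      ultimately show ?thesis
        using ne ub' unfolding directed_set_def split_beta by blast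
    qed
    show "\<forall>\<gamma>\<in>G \<times> H. \<forall>\<delta>\<in>G \<times> H. (case \<gamma> of (a, b) \<Rightarrow> \<lambda>(a', b'). leG a a' \<and> leH b b') \<delta> \<longrightarrow>
       (case \<delta> of (a, b) \<Rightarrow> e a + f b) \<le> (case \<gamma> of (a, b) \<Rightarrow> e a + f b)"
      using G H unfolding decreasing_to_0_def by (auto intro: add_mono)
    have glbH: "isGlb UNIV (f ` H) 0" using H unfolding decreasing_to_0_def by blast
    have "l \<le> 0" if l: "\<And>a b. a \<in> G \<Longrightarrow> b \<in> H \<Longrightarrow> l \<le> e a + f b" for l
    proof (rule le0)
      fix a assume "a \<in> G"
      then have "\<forall>b\<in>H. l - e a \<le> f b" using l by (simp add: diff_le_eq add.commute)
      then have "l - e a \<le> 0" using glbH unfolding isGlb_UNIV_iff by blast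
      then show "l \<le> e a" by simp
    qed
    then show "isGlb UNIV ((\<lambda>(a, b). e a + f b) ` (G \<times> H)) 0"
      using glb glbH unfolding isGlb_UNIV_iff by (force intro: add_nonneg_nonneg)
  qed
  then have "bo_converges_to nrm A le v x"
  proof (rule bo_converges_toI)
    fix p assume "p \<in> G \<times> H"
    then obtain \<gamma> \<delta> where p: "p = (\<gamma>, \<delta>)" "\<gamma> \<in> G" "\<delta> \<in> H" by blast
    obtain a where a: "a \<in> G" "\<And>b. b \<in> G \<Longrightarrow> leG a b \<Longrightarrow> nrm (x - v (k b)) \<le> f \<delta>"
      using evH p by blast
    obtain c where c: "c \<in> G" "leG \<gamma> c" "leG a c"
      using dirG a p unfolding directed_set_def by blast
    have "nrm (x - v b) \<le> e \<gamma> + f \<delta>" if b: "b \<in> A" "le (k c) b" for b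
    proof -
      have "nrm (x - v b) \<le> nrm (x - v (k c)) + nrm (v (k c) - v b)" by (rule nrm_diff_triangle)
      also have "\<dots> \<le> f \<delta> + e c"
        using a c k[of c "k c" b] kA refl b by (intro add_mono) auto
      also have "\<dots> \<le> f \<delta> + e \<gamma>" using mono c p by (intro add_mono) auto
      finally show ?thesis by (simp add: add.commute)
    qed
    then show "\<exists>a\<in>A. \<forall>b\<in>A. le a b \<longrightarrow> nrm (x - v b) \<le> (case p of (a, b) \<Rightarrow> e a + f b)"
      using kA c p by auto
  qed
  then show ?thesis by blast
qed

end


lemma lattice_normed_space_abs: "lattice_normed_space (abs :: 'e::archimedean_vector_lattice \<Rightarrow> 'e)"
proof
  fix v w :: 'e and c :: real
  show "\<bar>v + w\<bar> \<le> \<bar>v\<bar> + \<bar>w\<bar>" by (rule abs_triangle_ineq)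
  have p: "\<bar>c *\<^sub>R v\<bar> \<le> c *\<^sub>R \<bar>v\<bar>" if "0 \<le> c" for c and v :: 'e
    using that abs_ge_self[of v] abs_ge_minus_self[of v]
    by (metis abs_leI scaleR_left_mono scaleR_minus_right)
  have q: "\<bar>c *\<^sub>R v\<bar> = c *\<^sub>R \<bar>v\<bar>" if "0 < c" for c and v :: 'e
  proof (rule order.antisym)
    show "\<bar>c *\<^sub>R v\<bar> \<le> c *\<^sub>R \<bar>v\<bar>" using p that by simp
    have "\<bar>inverse c *\<^sub>R (c *\<^sub>R v)\<bar> \<le> inverse c *\<^sub>R \<bar>c *\<^sub>R v\<bar>"
      using p[of "inverse c" "c *\<^sub>R v"] that by simp
    then have "c *\<^sub>R \<bar>v\<bar> \<le> c *\<^sub>R (inverse c *\<^sub>R \<bar>c *\<^sub>R v\<bar>)" using that by (intro scaleR_left_mono) auto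
    then show "c *\<^sub>R \<bar>v\<bar> \<le> \<bar>c *\<^sub>R v\<bar>" using that by simp
  qed
  show "\<bar>c *\<^sub>R v\<bar> = \<bar>c\<bar> *\<^sub>R \<bar>v\<bar>"
    using q[of c v] q[of "-c" v] by (cases c "0::real" rule: linorder_cases) auto
qed auto


subsection \<open>Orthogonally additive and dominated Uryson operators\<close>

text \<open>
  A vector lattice is the lattice-normed space with norm \<^const>\<open>abs\<close>, so that
  \<open>orthogonally_additive abs S\<close> is orthogonal additivity of \<open>S\<close> between
  vector lattices.
\<close>

definition orthogonally_additive ::
  "('v::real_vector \<Rightarrow> 'e::archimedean_vector_lattice) \<Rightarrow> ('v \<Rightarrow> 'w::real_vector) \<Rightarrow> bool" where
  "orthogonally_additive nrm T \<longleftrightarrow>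
    (\<forall>u v. disjoint_elts nrm u v \<longrightarrow> T (u + v) = T u + T v)"

definition positive_op ::
  "('e::archimedean_vector_lattice \<Rightarrow> 'f::archimedean_vector_lattice) \<Rightarrow> bool" where
  "positive_op S \<longleftrightarrow> (\<forall>x. 0 \<le> S x)"

definition order_bounded_set :: "'e::archimedean_vector_lattice set \<Rightarrow> bool" where
  "order_bounded_set A \<longleftrightarrow> (\<exists>a b. A \<subseteq> {a..b})"

definition order_bounded_op ::
  "('e::archimedean_vector_lattice \<Rightarrow> 'f::archimedean_vector_lattice) \<Rightarrow> bool" where
  "order_bounded_op S \<longleftrightarrow> (\<forall>A. order_bounded_set A \<longrightarrow> order_bounded_set (S ` A))"

definition even_op ::
  "('e::archimedean_vector_lattice \<Rightarrow> 'f::archimedean_vector_lattice) \<Rightarrow> bool" where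
  "even_op S \<longleftrightarrow> (\<forall>x. S x = S (- x))"

definition abstract_uryson ::
  "('e::archimedean_vector_lattice \<Rightarrow> 'f::archimedean_vector_lattice) \<Rightarrow> bool" where
  "abstract_uryson S \<longleftrightarrow> orthogonally_additive abs S \<and> order_bounded_op S"

definition uryson_pos_even ::
  "('e::archimedean_vector_lattice \<Rightarrow> 'f::archimedean_vector_lattice) set" where
  "uryson_pos_even = {S. abstract_uryson S \<and> positive_op S \<and> even_op S}"

definition op_le ::
  "('e::archimedean_vector_lattice \<Rightarrow> 'f::archimedean_vector_lattice) \<Rightarrow> ('e \<Rightarrow> 'f) \<Rightarrow> bool" where
  "op_le S1 S2 \<longleftrightarrow> positive_op (\<lambda>x. S2 x - S1 x)"

definition dominant ::
  "('v::real_vector \<Rightarrow> 'e::archimedean_vector_lattice) \<Rightarrow>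
    ('w::real_vector \<Rightarrow> 'f::archimedean_vector_lattice) \<Rightarrow> ('v \<Rightarrow> 'w) \<Rightarrow> ('e \<Rightarrow> 'f) \<Rightarrow> bool" where
  "dominant nV nW T S \<longleftrightarrow> S \<in> uryson_pos_even \<and> (\<forall>v. nW (T v) \<le> S (nV v))"

definition dominated_uryson ::
  "('v::real_vector \<Rightarrow> 'e::archimedean_vector_lattice) \<Rightarrow>
    ('w::real_vector \<Rightarrow> 'f::archimedean_vector_lattice) \<Rightarrow> ('v \<Rightarrow> 'w) \<Rightarrow> bool" where
  "dominated_uryson nV nW T \<longleftrightarrow> orthogonally_additive nV T \<and> (\<exists>S. dominant nV nW T S)"

definition exact_dominant ::
  "('v::real_vector \<Rightarrow> 'e::archimedean_vector_lattice) \<Rightarrow>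
    ('w::real_vector \<Rightarrow> 'f::archimedean_vector_lattice) \<Rightarrow> ('v \<Rightarrow> 'w) \<Rightarrow> 'e \<Rightarrow> 'f" where
  "exact_dominant nV nW T =
    (THE S. dominant nV nW T S \<and> (\<forall>S'. dominant nV nW T S' \<longrightarrow> op_le S S'))"


subsection \<open>Complete additivity\<close>

definition has_bo_sum ::
  "('v::real_vector \<Rightarrow> 'e::archimedean_vector_lattice) \<Rightarrow> 'i set \<Rightarrow> ('i \<Rightarrow> 'v) \<Rightarrow> 'v \<Rightarrow> bool" where
  "has_bo_sum nrm \<Lambda> v s \<longleftrightarrow>
    bo_converges_to nrm {\<theta>. finite \<theta> \<and> \<theta> \<subseteq> \<Lambda>} (\<subseteq>) (\<lambda>\<theta>. \<Sum>\<alpha>\<in>\<theta>. v \<alpha>) s"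

text \<open>
  The index set of the family is taken inside \<open>'v\<close>; by \<open>completely_additiveD\<close> below
  the condition then holds for families over arbitrary index types, because the nonzero
  members of a disjoint family are distinct.
\<close>

definition completely_additive ::
  "('v::real_vector \<Rightarrow> 'e::archimedean_vector_lattice) \<Rightarrow>
    ('w::real_vector \<Rightarrow> 'f::archimedean_vector_lattice) \<Rightarrow> ('v \<Rightarrow> 'w) \<Rightarrow> bool" where
  "completely_additive nV nW T \<longleftrightarrow>
    orthogonally_additive nV T \<and>
    (\<forall>(\<Lambda>::'v set) v s.
      (\<forall>\<alpha>\<in>\<Lambda>. \<forall>\<beta>\<in>\<Lambda>. \<alpha> \<noteq> \<beta> \<longrightarrow> disjoint_elts nV (v \<alpha>) (v \<beta>)) \<longrightarrow>
      has_bo_sum nV \<Lambda> v s \<longrightarrow> has_bo_sum nW \<Lambda> (\<lambda>\<alpha>. T (v \<alpha>)) (T s))"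

lemma (in lattice_normed_space) completely_additiveD:
  fixes \<Lambda> :: "'i set" and nW :: "'w::real_vector \<Rightarrow> 'f::archimedean_vector_lattice"
  assumes ca: "completely_additive nrm nW T"
    and disj: "\<And>\<alpha> \<beta>. \<alpha> \<in> \<Lambda> \<Longrightarrow> \<beta> \<in> \<Lambda> \<Longrightarrow> \<alpha> \<noteq> \<beta> \<Longrightarrow> disjoint_elts nrm (v \<alpha>) (v \<beta>)"
    and sum: "has_bo_sum nrm \<Lambda> v s"
  shows "has_bo_sum nW \<Lambda> (\<lambda>\<alpha>. T (v \<alpha>)) (T s)"
proof -
  define M where "M = {\<alpha>\<in>\<Lambda>. v \<alpha> \<noteq> 0}"
  have "disjoint_elts nrm 0 0" using nrm_eq_0_iff[of 0] by (simp add: disjoint_elts_def)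
  then have "T (0 + 0) = T 0 + T 0"
    using ca unfolding completely_additive_def orthogonally_additive_def by blast
  then have T0: "T 0 = 0" by simp
  have inj: "inj_on v M"
  proof (rule inj_onI, rule ccontr)
    fix \<alpha> \<beta> assume *: "\<alpha> \<in> M" "\<beta> \<in> M" "v \<alpha> = v \<beta>" "\<alpha> \<noteq> \<beta>"
    then have "disjoint_elts nrm (v \<alpha>) (v \<beta>)" by (intro disj) (auto simp: M_def)
    then have "nrm (v \<alpha>) = 0" using * by (simp add: disjoint_elts_def)
    then show False using * nrm_eq_0_iff by (auto simp: M_def)
  qed
  have reindex: "(\<Sum>\<alpha>\<in>\<theta>. g (v \<alpha>)) = (\<Sum>x\<in>v ` (\<theta> \<inter> M). g x)"
    if "finite \<theta>" "\<theta> \<subseteq> \<Lambda>" "g 0 = 0" for \<theta> and g :: "'v \<Rightarrow> 'x::real_vector"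
  proof -
    have "(\<Sum>x\<in>v ` (\<theta> \<inter> M). g x) = (\<Sum>\<alpha>\<in>\<theta> \<inter> M. g (v \<alpha>))"
      using inj by (subst sum.reindex) (auto intro: inj_on_subset)
    also have "\<dots> = (\<Sum>\<alpha>\<in>\<theta>. g (v \<alpha>))"
      using that by (intro sum.mono_neutral_left) (auto simp: M_def)
    finally show ?thesis by simp
  qed
  have sum': "has_bo_sum nrm (v ` M) (\<lambda>x. x) s"
  proof -
    obtain G :: "'e set" and leG e where G: "decreasing_to_0 G leG e"
      and ev: "\<forall>\<gamma>\<in>G. \<exists>a\<in>{\<theta>. finite \<theta> \<and> \<theta> \<subseteq> \<Lambda>}. \<forall>b\<in>{\<theta>. finite \<theta> \<and> \<theta> \<subseteq> \<Lambda>}.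
        a \<subseteq> b \<longrightarrow> nrm (s - (\<Sum>\<alpha>\<in>b. v \<alpha>)) \<le> e \<gamma>"
      using sum unfolding has_bo_sum_def bo_converges_to_def by (elim exE conjE)
    show ?thesis unfolding has_bo_sum_def using G
    proof (rule bo_converges_toI)
      fix \<gamma> assume "\<gamma> \<in> G"
      then obtain a where a: "finite a" "a \<subseteq> \<Lambda>"
        and *: "\<And>b. finite b \<Longrightarrow> b \<subseteq> \<Lambda> \<Longrightarrow> a \<subseteq> b \<Longrightarrow> nrm (s - (\<Sum>\<alpha>\<in>b. v \<alpha>)) \<le> e \<gamma>"
        using bspec[OF ev \<open>\<gamma> \<in> G\<close>] by (elim bexE) (rule that, auto)
      have "nrm (s - (\<Sum>x\<in>\<eta>. x)) \<le> e \<gamma>" if \<eta>: "finite \<eta>" "\<eta> \<subseteq> v ` M" "v ` (a \<inter> M) \<subseteq> \<eta>" for \<eta>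
      proof -
        define b where "b = a \<union> inv_into M v ` \<eta>"
        have inM: "inv_into M v ` \<eta> \<subseteq> M" using \<eta>(2) inv_into_into[of _ v M] by blast
        then have fb: "finite b" "b \<subseteq> \<Lambda>" "a \<subseteq> b" using a \<eta> by (auto simp: b_def M_def)
        have "v ` inv_into M v ` \<eta> = \<eta>" using \<eta>(2) by (rule image_inv_into_cancel[OF refl])
        moreover have "b \<inter> M = (a \<inter> M) \<union> inv_into M v ` \<eta>" using inM unfolding b_def by blast
        ultimately have "v ` (b \<inter> M) = \<eta>" using \<eta>(3) by (simp add: image_Un Un_absorb1)
        then have "(\<Sum>\<alpha>\<in>b. v \<alpha>) = (\<Sum>x\<in>\<eta>. x)"
          using reindex[of b "\<lambda>x. x"] fb by simp
        then show ?thesis using *[OF fb] by simp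
      qed
      then show "\<exists>a\<in>{\<theta>. finite \<theta> \<and> \<theta> \<subseteq> v ` M}. \<forall>b\<in>{\<theta>. finite \<theta> \<and> \<theta> \<subseteq> v ` M}.
        a \<subseteq> b \<longrightarrow> nrm (s - (\<Sum>x\<in>b. x)) \<le> e \<gamma>"
        using a by (intro bexI[of _ "v ` (a \<inter> M)"]) auto
    qed
  qed
  have "disjoint_elts nrm x y" if xy: "x \<in> v ` M" "y \<in> v ` M" "x \<noteq> y" for x y
  proof -
    obtain \<alpha> \<beta> where "x = v \<alpha>" "y = v \<beta>" "\<alpha> \<in> M" "\<beta> \<in> M" using xy(1,2) by (elim imageE) (rule that)
    note xv = this
    then have "\<alpha> \<in> \<Lambda>" "\<beta> \<in> \<Lambda>" by (simp_all add: M_def)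
    moreover have "\<alpha> \<noteq> \<beta>" using xv(1,2) xy(3) by metis
    ultimately have "disjoint_elts nrm (v \<alpha>) (v \<beta>)" by (rule disj)
    then show ?thesis by (simp only: xv(1,2))
  qed
  moreover have "(\<forall>\<alpha>\<in>v ` M. \<forall>\<beta>\<in>v ` M. \<alpha> \<noteq> \<beta> \<longrightarrow> disjoint_elts nrm \<alpha> \<beta>) \<longrightarrow>
      has_bo_sum nrm (v ` M) (\<lambda>x. x) s \<longrightarrow> has_bo_sum nW (v ` M) (\<lambda>x. T x) (T s)"
    using ca unfolding completely_additive_def by (elim conjE allE)
  ultimately have "has_bo_sum nW (v ` M) T (T s)" using sum' by simp
  then obtain G :: "'f set" and leG e where G: "decreasing_to_0 G leG e"
    and ev: "\<forall>\<gamma>\<in>G. \<exists>a\<in>{\<theta>. finite \<theta> \<and> \<theta> \<subseteq> v ` M}. \<forall>b\<in>{\<theta>. finite \<theta> \<and> \<theta> \<subseteq> v ` M}.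
      a \<subseteq> b \<longrightarrow> nW (T s - (\<Sum>x\<in>b. T x)) \<le> e \<gamma>"
    unfolding has_bo_sum_def bo_converges_to_def by (elim exE conjE)
  show ?thesis unfolding has_bo_sum_def using G
  proof (rule bo_converges_toI)
    fix \<gamma> assume "\<gamma> \<in> G"
    then obtain a where a: "finite a" "a \<subseteq> v ` M"
      and *: "\<And>b. finite b \<Longrightarrow> b \<subseteq> v ` M \<Longrightarrow> a \<subseteq> b \<Longrightarrow> nW (T s - (\<Sum>x\<in>b. T x)) \<le> e \<gamma>"
      using bspec[OF ev \<open>\<gamma> \<in> G\<close>] by (elim bexE) (rule that, auto)
    obtain c where c: "c \<subseteq> M" "finite c" "a = v ` c" using finite_subset_image[OF a] by blast
    have "nW (T s - (\<Sum>\<alpha>\<in>b. T (v \<alpha>))) \<le> e \<gamma>" if "finite b" "b \<subseteq> \<Lambda>" "c \<subseteq> b" for b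
    proof -
      have "a \<subseteq> v ` (b \<inter> M)" using c that by blast
      then have "nW (T s - (\<Sum>x\<in>v ` (b \<inter> M). T x)) \<le> e \<gamma>" using that by (intro *) auto
      then show ?thesis using reindex[of b T] T0 that by simp
    qed
    then show "\<exists>a\<in>{\<theta>. finite \<theta> \<and> \<theta> \<subseteq> \<Lambda>}. \<forall>b\<in>{\<theta>. finite \<theta> \<and> \<theta> \<subseteq> \<Lambda>}.
        a \<subseteq> b \<longrightarrow> nW (T s - (\<Sum>\<alpha>\<in>b. T (v \<alpha>))) \<le> e \<gamma>"
      using c by (intro bexI[of _ c]) (auto simp: M_def)
  qed
qed

end

theory Submission
  imports Defs
begin

text \<open>
  Everything rests on a formula for the exact dominant. Let \<open>N e\<close> be the supremum of the sums
  \<open>\<Sum>u\<in>U. nW (T u)\<close> over the finite sets \<open>U\<close> of pairwise disjoint elements of \<open>V\<close> whose norms are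
  fragments of \<open>\<bar>e\<bar>\<close> (\<open>x\<close> is a fragment of \<open>e\<close> if \<open>x\<close> and \<open>e - x\<close> are disjoint). Every dominant \<open>S\<close>
  bounds these sums by \<open>S e\<close>, because \<open>S\<close> is positive and additive on disjoint elements. Conversely
  \<open>N\<close> is itself a dominant: if \<open>e\<close> and \<open>f\<close> are disjoint, decomposability splits an element whose
  norm is a fragment of \<open>\<bar>e + f\<bar>\<close> into a part below \<open>\<bar>e\<bar>\<close> and a part below \<open>\<bar>f\<bar>\<close>, and this gives
  additivity. So \<open>N\<close> is the exact dominant (\<open>exact_dominant_eq_variation\<close>).

  Suppose that \<open>N\<close> is completely additive and that the disjoint family \<open>v\<close> sums to \<open>s\<close>. The
  remainder \<open>s - w\<close> of a finite partial sum \<open>w\<close> is disjoint from \<open>w\<close>, so that \<open>T s - T w = T (s - w)\<close>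
  has norm at most \<open>N (nV (s - w)) = N (nV s) - N (nV w)\<close>. The norms of the
  \<open>v \<alpha>\<close> sum to the norm of \<open>s\<close>, so that this difference tends to \<open>0\<close> by the assumption on \<open>N\<close>.

  Suppose that \<open>T\<close> is completely additive and that the disjoint family \<open>e\<close> sums to \<open>s\<close> in \<open>E\<close>.
  The differences \<open>N s - (\<Sum>\<alpha>\<in>\<theta>. N (e \<alpha>))\<close> are positive and decrease as \<open>\<theta>\<close> grows, hence it
  suffices that every upper bound \<open>m\<close> of the finite sums of the \<open>N (e \<alpha>)\<close> is at least \<open>N s\<close>. Take a
  set \<open>U\<close> as in the formula for \<open>N s\<close>. Each \<open>u \<in> U\<close> is the sum of its components of norm
  \<open>inf (nV u) \<bar>e \<alpha>\<bar>\<close>, and \<open>T u\<close> is the sum of their images. For a fixed \<open>\<alpha>\<close> the components of all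
  \<open>u \<in> U\<close> are disjoint with norms that are fragments of \<open>\<bar>e \<alpha>\<bar>\<close>, so that their images contribute at
  most \<open>N (e \<alpha>)\<close>. Summing up yields \<open>(\<Sum>u\<in>U. nW (T u)) \<le> m\<close> (\<open>variation_le_of_sums\<close>).
\<close>

section \<open>Disjointness and fragments in a vector lattice\<close>

text \<open>
  Both \<open>a\<close> and \<open>b\<close>, each increased by \<open>inf a c\<close>, are upper bounds of the left-hand side, and
  addition distributes over \<^const>\<open>inf\<close>.
\<close>

lemma inf_add_le:
  fixes a b c :: "'a::lattice_ab_group_add"
  assumes "0 \<le> a" "0 \<le> b" "0 \<le> c"
  shows "inf a (b + c) \<le> inf a b + inf a c"
proof -
  have "inf a (b + c) \<le> a + inf a c" "inf a (b + c) \<le> b + inf a c"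
  proof -
    show "inf a (b + c) \<le> a + inf a c"
      using assms by (meson inf_le1 add_increasing2 le_inf_iff order_trans)
    have "b + inf a c = inf (b + a) (b + c)" by (rule add_inf_distrib_left)
    moreover have "inf a (b + c) \<le> b + a" using assms by (meson inf_le1 add_increasing order_trans order_refl)
    ultimately show "inf a (b + c) \<le> b + inf a c" by simp
  qed
  then show ?thesis by (simp add: add_inf_distrib_right)
qed

lemma disjoint_add_eq_sup:
  fixes a b :: "'a::lattice_ab_group_add"
  assumes "inf a b = 0"
  shows "a + b = sup a b"
  using add_eq_inf_sup[of a b] assms by simp

lemma inf_eq_0_mono:
  fixes a b :: "'a::lattice_ab_group_add"
  assumes "inf a b = 0" "0 \<le> a'" "a' \<le> a" "0 \<le> b'" "b' \<le> b"
  shows "inf a' b' = 0"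
  using assms by (metis inf_mono le_inf_iff order.antisym)

lemma inf_add_eq_0:
  fixes a b c :: "'a::lattice_ab_group_add"
  assumes "inf a b = 0" "inf a c = 0"
  shows "inf a (b + c) = 0"
proof (rule order.antisym)
  have "0 \<le> a" "0 \<le> b" "0 \<le> c" using assms by (metis inf_le1 inf_le2)+
  then show "inf a (b + c) \<le> 0" "0 \<le> inf a (b + c)"
    using inf_add_le[of a b c] assms by auto
qed

text \<open>
  The condition contains \<open>0 \<le> x \<le> e\<close>, since the infimum \<open>0\<close> is a lower bound of \<open>x\<close> and \<open>e - x\<close>.
\<close>

definition fragment :: "'a::lattice_ab_group_add \<Rightarrow> 'a \<Rightarrow> bool" where
  "fragment x e \<longleftrightarrow> inf x (e - x) = 0"

lemma fragment_nonneg: "fragment x e \<Longrightarrow> 0 \<le> x"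
  unfolding fragment_def by (metis inf_le1)

lemma fragment_le: "fragment x e \<Longrightarrow> x \<le> e"
  unfolding fragment_def by (metis inf_le2 diff_ge_0_iff_ge)

lemma fragment_self: "0 \<le> x \<Longrightarrow> fragment x x"
  unfolding fragment_def by (simp add: inf_absorb2)

lemma fragment_add:
  assumes "fragment x a" "inf a b = 0"
  shows "fragment x (a + b)"
proof -
  have "0 \<le> b" using assms(2) by (metis inf_le2)
  then have "inf x b = 0"
    using inf_eq_0_mono[OF assms(2)] fragment_nonneg fragment_le assms(1) by blast
  then have "inf x ((a - x) + b) = 0"
    using assms(1) unfolding fragment_def by (intro inf_add_eq_0)
  then show ?thesis by (simp add: fragment_def algebra_simps)
qed

lemma fragment_diff:
  assumes "fragment y a" "fragment x a" "inf x y = 0"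
  shows "fragment y (a - x)"
proof -
  have "x + y \<le> a" using assms by (simp add: disjoint_add_eq_sup fragment_le)
  then have "0 \<le> a - x - y" by (simp add: algebra_simps)
  moreover have "a - x - y \<le> a - y" using fragment_nonneg[OF assms(2)] by simp
  ultimately show ?thesis
    using assms(1) inf_eq_0_mono[of y "a - y" y "a - x - y"] fragment_nonneg[OF assms(1)]
    unfolding fragment_def by simp
qed

text \<open>
  Cutting down to \<open>a\<close> leaves \<open>a - inf x a\<close>, the positive part of \<open>a - x\<close>, which is below the
  complement \<open>a + b - x\<close> of \<open>x\<close>.
\<close>

lemma fragment_inf:
  assumes "fragment x (a + b)" "0 \<le> a" "0 \<le> b"
  shows "fragment (inf x a) a"
proof -
  have x: "0 \<le> x" by (rule fragment_nonneg) fact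
  have "a - inf x a = sup (a - x) 0"
    by (simp add: diff_inf_eq_sup add_sup_distrib_left)
  moreover have "sup (a - x) 0 \<le> a + b - x"
    using assms(2,3) fragment_le[OF assms(1)] by (intro sup_least) (simp_all add: algebra_simps)
  ultimately show ?thesis
    using assms(1,2) x inf_eq_0_mono[of x "a + b - x" "inf x a" "a - inf x a"]
    unfolding fragment_def by simp
qed

lemma fragment_split:
  assumes "fragment x (a + b)" "inf a b = 0"
  shows "inf x a + inf x b = x"
proof (rule order.antisym)
  have nn: "0 \<le> a" "0 \<le> b" using assms(2) by (metis inf_le1 inf_le2)+
  have x: "0 \<le> x" by (rule fragment_nonneg) fact
  have "inf (inf x a) (inf x b) = 0"
    using nn x by (intro inf_eq_0_mono[OF assms(2)]) auto
  then show "inf x a + inf x b \<le> x" by (simp add: disjoint_add_eq_sup)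
  have "x = inf x (a + b)" using fragment_le[OF assms(1)] by (simp add: inf_absorb1)
  also have "\<dots> \<le> inf x a + inf x b" using inf_add_le x nn by blast
  finally show "x \<le> inf x a + inf x b" .
qed


section \<open>Disjoint sums in a lattice-normed space\<close>

context lattice_normed_space
begin

lemma nrm_zero [simp]: "nrm 0 = 0"
  by (simp add: nrm_eq_0_iff)

lemma nrm_minus [simp]: "nrm (- x) = nrm x"
  using nrm_scaleR[of "-1" x] by simp

lemma disjoint_elts_commute: "disjoint_elts nrm u v \<longleftrightarrow> disjoint_elts nrm v u"
  by (simp add: disjoint_elts_def inf_commute)

lemma disjoint_elts_zero [simp]: "disjoint_elts nrm u 0"
  by (simp add: disjoint_elts_def inf_absorb2 nrm_nonneg)

lemma disjoint_elts_self: "disjoint_elts nrm u u \<longleftrightarrow> u = 0"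
  by (simp add: disjoint_elts_def nrm_eq_0_iff)

lemma disjoint_elts_add:
  assumes "disjoint_elts nrm u v" "disjoint_elts nrm u w"
  shows "disjoint_elts nrm u (v + w)"
  unfolding disjoint_elts_def
  using assms inf_eq_0_mono[of "nrm u" "nrm v + nrm w" "nrm u" "nrm (v + w)"]
  by (simp add: disjoint_elts_def inf_add_eq_0 nrm_nonneg nrm_triangle)

lemma disjoint_elts_minus:
  "disjoint_elts nrm u v \<Longrightarrow> disjoint_elts nrm u (- v)"
  by (simp add: disjoint_elts_def)

lemma disjoint_elts_sum:
  assumes "\<And>i. i \<in> I \<Longrightarrow> disjoint_elts nrm u (v i)"
  shows "disjoint_elts nrm u (\<Sum>i\<in>I. v i)"
  using assms by (induction I rule: infinite_finite_induct) (auto intro: disjoint_elts_add)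

text \<open>
  The triangle inequality \<open>nrm a \<le> nrm (a + b) + nrm b\<close> loses its last term when it is
  intersected with \<open>nrm a\<close>. Hence \<open>nrm (u + v)\<close> is above both norms and above their supremum, which
  for disjoint elements is the sum.
\<close>

lemma nrm_add_disjoint:
  assumes "disjoint_elts nrm u v"
  shows "nrm (u + v) = nrm u + nrm v"
proof (rule order.antisym)
  have *: "nrm a \<le> nrm (a + b)" if "disjoint_elts nrm a b" for a b
  proof -
    have "nrm a \<le> nrm (a + b) + nrm b"
      using nrm_triangle[of "a + b" "- b"] by simp
    then have "nrm a = inf (nrm a) (nrm (a + b) + nrm b)" by (simp add: inf_absorb1)
    also have "\<dots> \<le> inf (nrm a) (nrm (a + b)) + inf (nrm a) (nrm b)"
      by (intro inf_add_le nrm_nonneg)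
    finally show ?thesis using that by (simp add: disjoint_elts_def)
  qed
  have "nrm u \<le> nrm (u + v)" "nrm v \<le> nrm (u + v)"
    using *[of u v] *[of v u] assms by (simp_all add: disjoint_elts_commute add.commute)
  then show "nrm u + nrm v \<le> nrm (u + v)"
    using assms by (simp add: disjoint_elts_def disjoint_add_eq_sup)
qed (rule nrm_triangle)

lemma nrm_sum_le: "nrm (\<Sum>i\<in>I. v i) \<le> (\<Sum>i\<in>I. nrm (v i))"
  by (induction I rule: infinite_finite_induct)
    (auto intro: order_trans[OF nrm_triangle] add_left_mono)

lemma orthogonally_additive_zero:
  assumes "orthogonally_additive nrm T"
  shows "T 0 = (0::'w::real_vector)"
proof -
  have "T (0 + 0) = T 0 + T 0"
    using assms disjoint_elts_zero unfolding orthogonally_additive_def by blast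
  then show ?thesis by simp
qed

lemma orthogonally_additive_sum:
  fixes T :: "'v \<Rightarrow> 'w::real_vector"
  assumes "orthogonally_additive nrm T" "finite I"
    and "pairwise (\<lambda>i j. disjoint_elts nrm (v i) (v j)) I"
  shows "T (\<Sum>i\<in>I. v i) = (\<Sum>i\<in>I. T (v i))"
  using assms(2,3)
proof (induction I rule: finite_induct)
  case empty
  show ?case using orthogonally_additive_zero[OF assms(1)] by simp
next
  case (insert i I)
  have "disjoint_elts nrm (v i) (\<Sum>j\<in>I. v j)"
    using insert.prems insert.hyps by (intro disjoint_elts_sum) (auto simp: pairwise_def)
  then have "T (v i + (\<Sum>j\<in>I. v j)) = T (v i) + T (\<Sum>j\<in>I. v j)"
    using assms(1) unfolding orthogonally_additive_def by blast
  then show ?case using insert by (simp add: pairwise_insert)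
qed

lemma orthogonally_additive_nrm: "orthogonally_additive nrm nrm"
  by (simp add: orthogonally_additive_def nrm_add_disjoint)

text \<open>
  This is the way in which limits are evaluated below: an inequality between constants that holds
  up to the error of the partial sums, from some partial sum on, holds exactly.
\<close>

lemma has_bo_sum_nrm_le:
  assumes "has_bo_sum nrm \<Lambda> v s"
    and "\<And>\<theta>. finite \<theta> \<Longrightarrow> \<theta> \<subseteq> \<Lambda> \<Longrightarrow> a \<subseteq> \<theta> \<Longrightarrow> l \<le> nrm (s - (\<Sum>\<alpha>\<in>\<theta>. v \<alpha>)) + m"
    and "finite a" "a \<subseteq> \<Lambda>"
  shows "l \<le> m"
proof -
  obtain G :: "'e set" and leG e where G: "decreasing_to_0 G leG e"
    and ev: "\<And>\<gamma>. \<gamma> \<in> G \<Longrightarrow> \<exists>b. (finite b \<and> b \<subseteq> \<Lambda>) \<and> (\<forall>c. (finite c \<and> c \<subseteq> \<Lambda>) \<longrightarrow> 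
        b \<subseteq> c \<longrightarrow> nrm (s - (\<Sum>\<alpha>\<in>c. v \<alpha>)) \<le> e \<gamma>)"
    using assms(1) unfolding has_bo_sum_def bo_converges_to_def Bex_def Ball_def mem_Collect_eq
    by blast
  have "l - m \<le> e \<gamma>" if \<gamma>: "\<gamma> \<in> G" for \<gamma>
  proof -
    obtain b where b: "finite b" "b \<subseteq> \<Lambda>"
      and *: "\<forall>c. (finite c \<and> c \<subseteq> \<Lambda>) \<longrightarrow> b \<subseteq> c \<longrightarrow> nrm (s - (\<Sum>\<alpha>\<in>c. v \<alpha>)) \<le> e \<gamma>"
      using ev[OF \<gamma>] by (elim exE conjE) (rule that)
    have "l \<le> nrm (s - (\<Sum>\<alpha>\<in>a \<union> b. v \<alpha>)) + m"
      using b assms(3,4) by (intro assms(2)) auto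
    also have "\<dots> \<le> e \<gamma> + m"
      using b assms(3,4) by (intro add_right_mono *[rule_format]) auto
    finally show ?thesis by (simp add: algebra_simps)
  qed
  then have "l - m \<le> 0"
    using G unfolding decreasing_to_0_def isGlb_UNIV_iff by blast
  then show ?thesis by simp
qed

text \<open>
  Up to the error of a later partial sum over \<open>\<eta>\<close>, the remainder after \<open>\<theta>\<close> is the sum over
  \<open>\<eta> - \<theta>\<close>, which is disjoint from the sum over \<open>\<theta>\<close>.
\<close>

lemma has_bo_sum_remainder_disjoint:
  assumes disj: "pairwise (\<lambda>\<alpha> \<beta>. disjoint_elts nrm (v \<alpha>) (v \<beta>)) \<Lambda>"
    and sum: "has_bo_sum nrm \<Lambda> v s" and \<theta>: "finite \<theta>" "\<theta> \<subseteq> \<Lambda>"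
  shows "disjoint_elts nrm (\<Sum>\<alpha>\<in>\<theta>. v \<alpha>) (s - (\<Sum>\<alpha>\<in>\<theta>. v \<alpha>))"
proof -
  let ?w = "\<lambda>\<theta>. \<Sum>\<alpha>\<in>\<theta>. v \<alpha>"
  have "inf (nrm (?w \<theta>)) (nrm (s - ?w \<theta>)) \<le> 0"
  proof (rule has_bo_sum_nrm_le[OF sum _ \<theta>])
    fix \<eta> assume \<eta>: "finite \<eta>" "\<eta> \<subseteq> \<Lambda>" "\<theta> \<subseteq> \<eta>"
    have w: "?w \<eta> - ?w \<theta> = ?w (\<eta> - \<theta>)" using \<eta> by (simp add: sum_diff)
    have "disjoint_elts nrm (v \<alpha>) (?w \<theta>)" if "\<alpha> \<in> \<eta> - \<theta>" for \<alpha>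
      using that disj \<eta>(2) \<theta>(2) unfolding pairwise_def
      by (intro disjoint_elts_sum) fast
    then have d: "disjoint_elts nrm (?w \<theta>) (?w (\<eta> - \<theta>))"
      by (intro disjoint_elts_sum) (simp add: disjoint_elts_commute)
    have "inf (nrm (?w \<theta>)) (nrm (s - ?w \<theta>)) 
        \<le> inf (nrm (?w \<theta>)) (nrm (s - ?w \<eta>) + nrm (?w \<eta> - ?w \<theta>))"
      by (intro inf_mono nrm_diff_triangle order_refl)
    also have "\<dots> \<le> inf (nrm (?w \<theta>)) (nrm (s - ?w \<eta>)) + inf (nrm (?w \<theta>)) (nrm (?w \<eta> - ?w \<theta>))"
      by (intro inf_add_le nrm_nonneg)
    also have "\<dots> \<le> nrm (s - ?w \<eta>) + 0"
      using d unfolding w disjoint_elts_def by simp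
    finally show "inf (nrm (?w \<theta>)) (nrm (s - ?w \<theta>)) \<le> nrm (s - ?w \<eta>) + 0" .
  qed
  then show ?thesis
    unfolding disjoint_elts_def by (intro order.antisym le_infI nrm_nonneg)
qed

lemma has_bo_sumI_nrm_le:
  fixes nrm' :: "'x::real_vector \<Rightarrow> 'e"
  assumes "has_bo_sum nrm \<Lambda> v s"
    and "\<And>\<theta>. finite \<theta> \<Longrightarrow> \<theta> \<subseteq> \<Lambda> \<Longrightarrow> 
      nrm' (t - (\<Sum>\<alpha>\<in>\<theta>. w \<alpha>)) \<le> nrm (s - (\<Sum>\<alpha>\<in>\<theta>. v \<alpha>))"
  shows "has_bo_sum nrm' \<Lambda> w t"
  using assms unfolding has_bo_sum_def bo_converges_to_def Bex_def Ball_def mem_Collect_eq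
  by (meson order_trans)

text \<open>By disjointness the partial sums of the norms are the norms of the partial sums.\<close>

lemma has_bo_sum_nrm:
  assumes "has_bo_sum nrm \<Lambda> v s"
    and "pairwise (\<lambda>\<alpha> \<beta>. disjoint_elts nrm (v \<alpha>) (v \<beta>)) \<Lambda>"
  shows "has_bo_sum abs \<Lambda> (\<lambda>\<alpha>. nrm (v \<alpha>)) (nrm s)"
  using assms(1)
proof (rule has_bo_sumI_nrm_le)
  fix \<theta> assume \<theta>: "finite \<theta>" "\<theta> \<subseteq> \<Lambda>"
  let ?w = "\<Sum>\<alpha>\<in>\<theta>. v \<alpha>"
  have "pairwise (\<lambda>\<alpha> \<beta>. disjoint_elts nrm (v \<alpha>) (v \<beta>)) \<theta>"
    using assms(2) \<theta>(2) by (rule pairwise_subset)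
  then have "(\<Sum>\<alpha>\<in>\<theta>. nrm (v \<alpha>)) = nrm ?w"
    using orthogonally_additive_sum[OF orthogonally_additive_nrm \<theta>(1)] by metis
  moreover have "nrm s = nrm ?w + nrm (s - ?w)"
    using nrm_add_disjoint[OF has_bo_sum_remainder_disjoint[OF assms(2,1) \<theta>]] by simp
  ultimately show "\<bar>nrm s - (\<Sum>\<alpha>\<in>\<theta>. nrm (v \<alpha>))\<bar> \<le> nrm (s - ?w)"
    by (simp add: nrm_nonneg)
qed

lemma fragment_decomposition:
  assumes "decomposable nrm" "fragment (nrm u) (a + b)" "inf a b = 0"
  obtains u1 u2 where "u = u1 + u2" "nrm u1 = inf (nrm u) a" "nrm u2 = inf (nrm u) b"
    "disjoint_elts nrm u1 u2"
proof -
  have nn: "0 \<le> a" "0 \<le> b" using assms(3) by (metis inf_le1 inf_le2)+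
  have "nrm u = inf (nrm u) a + inf (nrm u) b"
    using fragment_split[OF assms(2,3)] by simp
  moreover have "0 \<le> inf (nrm u) a" "0 \<le> inf (nrm u) b" using nn nrm_nonneg by auto
  ultimately obtain u1 u2 where u: "u = u1 + u2" "nrm u1 = inf (nrm u) a" "nrm u2 = inf (nrm u) b"
    using assms(1) unfolding decomposable_def by blast
  moreover have "disjoint_elts nrm u1 u2"
    unfolding disjoint_elts_def u(2,3) using nn nrm_nonneg
    by (intro inf_eq_0_mono[OF assms(3)]) auto
  ultimately show ?thesis using that by blast
qed

end

interpretation abs: lattice_normed_space "abs :: 'e::archimedean_vector_lattice \<Rightarrow> 'e"
  by (rule lattice_normed_space_abs)


text \<open>
  The bands of the \<open>e \<alpha>\<close> cut every \<open>u\<close> below \<open>\<bar>s\<bar>\<close> into components \<open>c \<alpha>\<close>, which sum to \<open>u\<close>.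
  The components are chosen independently of each other, so it is not obvious that finitely many
  of them still form a component of \<open>u\<close>; this holds because splitting off one more \<open>c \<beta>\<close> from a
  remainder always lowers its norm by exactly \<open>nrm (c \<beta>)\<close>. The norm of the remainder is then
  \<open>nrm u - (\<Sum>\<alpha>\<in>\<theta>. inf (nrm u) \<bar>e \<alpha>\<bar>)\<close>, which lies below the remainder of the series of the
  \<open>e \<alpha>\<close>.
\<close>

lemma (in lattice_normed_space) bo_sum_of_components:
  assumes disj: "pairwise (\<lambda>\<alpha> \<beta>. disjoint_elts abs (e \<alpha>) (e \<beta>)) \<Lambda>"
    and sum: "has_bo_sum abs \<Lambda> e s" and u: "nrm u \<le> \<bar>s\<bar>"
    and comp: "\<And>\<alpha>. \<alpha> \<in> \<Lambda> \<Longrightarrow> nrm (c \<alpha>) = inf (nrm u) \<bar>e \<alpha>\<bar>"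
      "\<And>\<alpha>. \<alpha> \<in> \<Lambda> \<Longrightarrow> disjoint_elts nrm (c \<alpha>) (u - c \<alpha>)"
  shows "has_bo_sum nrm \<Lambda> c u"
    and "pairwise (\<lambda>\<alpha> \<beta>. disjoint_elts nrm (c \<alpha>) (c \<beta>)) \<Lambda>"
proof -
  show dc: "pairwise (\<lambda>\<alpha> \<beta>. disjoint_elts nrm (c \<alpha>) (c \<beta>)) \<Lambda>"
  proof (rule pairwiseI)
    fix \<alpha> \<beta> assume "\<alpha> \<in> \<Lambda>" "\<beta> \<in> \<Lambda>" "\<alpha> \<noteq> \<beta>"
    then show "disjoint_elts nrm (c \<alpha>) (c \<beta>)"
      using disj comp(1) inf_eq_0_mono[of "\<bar>e \<alpha>\<bar>" "\<bar>e \<beta>\<bar>" "inf (nrm u) \<bar>e \<alpha>\<bar>" "inf (nrm u) \<bar>e \<beta>\<bar>"]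
      by (simp add: disjoint_elts_def pairwise_def nrm_nonneg)
  qed
  show "has_bo_sum nrm \<Lambda> c u"
    using sum
  proof (rule abs.has_bo_sumI_nrm_le)
    fix \<theta> assume \<theta>: "finite \<theta>" "\<theta> \<subseteq> \<Lambda>"
    let ?w = "\<Sum>\<alpha>\<in>\<theta>. e \<alpha>"
    have "nrm (u - (\<Sum>\<alpha>\<in>\<theta>. c \<alpha>)) + (\<Sum>\<alpha>\<in>\<theta>. nrm (c \<alpha>)) = nrm u"
      using \<theta>
    proof (induction \<theta> rule: finite_induct)
      case (insert \<beta> \<theta>)
      \<comment> \<open>\<open>c \<beta>\<close> is disjoint from the rest of \<open>u\<close> and from the earlier components, hence from the
        new remainder.\<close>
      have "disjoint_elts nrm (c \<beta>) (\<Sum>\<alpha>\<in>\<theta>. c \<alpha>)"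
        using insert.prems insert.hyps by (intro disjoint_elts_sum pairwiseD[OF dc]) auto
      then have "disjoint_elts nrm (c \<beta>) ((u - c \<beta>) + - (\<Sum>\<alpha>\<in>\<theta>. c \<alpha>))"
        using insert.prems comp(2) by (intro disjoint_elts_add disjoint_elts_minus) auto
      from nrm_add_disjoint[OF this]
      have "nrm (u - (\<Sum>\<alpha>\<in>\<theta>. c \<alpha>)) = nrm (c \<beta>) + nrm (u - (\<Sum>\<alpha>\<in>insert \<beta> \<theta>. c \<alpha>))"
        using insert.hyps by (simp add: diff_diff_eq)
      then show ?case using insert.IH insert.prems insert.hyps by (simp add: ac_simps)
    qed simp
    moreover have "nrm u \<le> (\<Sum>\<alpha>\<in>\<theta>. nrm (c \<alpha>)) + \<bar>s - ?w\<bar>"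
    proof -
      have "nrm u \<le> \<bar>?w + (s - ?w)\<bar>" using u by simp
      also have "\<dots> \<le> \<bar>?w\<bar> + \<bar>s - ?w\<bar>" by (rule abs_triangle_ineq)
      also have "\<bar>?w\<bar> \<le> (\<Sum>\<alpha>\<in>\<theta>. \<bar>e \<alpha>\<bar>)" by (rule abs.nrm_sum_le)
      finally have "nrm u \<le> (\<Sum>\<alpha>\<in>\<theta>. \<bar>e \<alpha>\<bar>) + \<bar>s - ?w\<bar>" by simp
      then have "nrm u = inf (nrm u) ((\<Sum>\<alpha>\<in>\<theta>. \<bar>e \<alpha>\<bar>) + \<bar>s - ?w\<bar>)" by (simp add: inf_absorb1)
      also have "\<dots> \<le> inf (nrm u) (\<Sum>\<alpha>\<in>\<theta>. \<bar>e \<alpha>\<bar>) + inf (nrm u) \<bar>s - ?w\<bar>"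
        by (intro inf_add_le nrm_nonneg sum_nonneg) auto
      also have "inf (nrm u) (\<Sum>\<alpha>\<in>\<theta>. \<bar>e \<alpha>\<bar>) \<le> (\<Sum>\<alpha>\<in>\<theta>. inf (nrm u) \<bar>e \<alpha>\<bar>)"
        using \<theta>(1)
      proof (induction \<theta> rule: finite_induct)
        case (insert \<beta> \<theta>)
        have "inf (nrm u) (\<bar>e \<beta>\<bar> + (\<Sum>\<alpha>\<in>\<theta>. \<bar>e \<alpha>\<bar>)) \<le> inf (nrm u) \<bar>e \<beta>\<bar> + inf (nrm u) (\<Sum>\<alpha>\<in>\<theta>. \<bar>e \<alpha>\<bar>)"
          by (intro inf_add_le nrm_nonneg sum_nonneg) auto
        also have "\<dots> \<le> inf (nrm u) \<bar>e \<beta>\<bar> + (\<Sum>\<alpha>\<in>\<theta>. inf (nrm u) \<bar>e \<alpha>\<bar>)"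
          by (intro add_left_mono insert.IH)
        finally show ?case using insert.hyps by simp
      qed (simp add: nrm_nonneg inf_absorb2)
      also have "\<dots> = (\<Sum>\<alpha>\<in>\<theta>. nrm (c \<alpha>))"
        using \<theta> comp(1) by (intro sum.cong) auto
      also have "inf (nrm u) \<bar>s - ?w\<bar> \<le> \<bar>s - ?w\<bar>" by simp
      finally show ?thesis by simp
    qed
    ultimately have "(\<Sum>\<alpha>\<in>\<theta>. nrm (c \<alpha>)) + nrm (u - (\<Sum>\<alpha>\<in>\<theta>. c \<alpha>)) \<le>
        (\<Sum>\<alpha>\<in>\<theta>. nrm (c \<alpha>)) + \<bar>s - ?w\<bar>"
      by (simp only: add.commute)
    then show "nrm (u - (\<Sum>\<alpha>\<in>\<theta>. c \<alpha>)) \<le> \<bar>s - ?w\<bar>"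
      by (rule add_le_imp_le_left)
  qed
qed

text \<open>
  Different members of \<open>U\<close> may use different finite sets \<open>\<theta>\<close>: by monotonicity these can be
  replaced by their union. This interchanges a finite sum with suprema, where \<open>x u\<close> stands for
  the supremum of \<open>a u\<close> but is only required to lie below every bound of \<open>a u\<close>.
\<close>

lemma sum_of_suprema_le:
  fixes a :: "'u \<Rightarrow> 'i set \<Rightarrow> 'f::ordered_ab_group_add"
  assumes "finite U"
    and mono: "\<And>u \<theta> \<eta>. u \<in> U \<Longrightarrow> finite \<eta> \<Longrightarrow> \<eta> \<subseteq> \<Lambda> \<Longrightarrow> \<theta> \<subseteq> \<eta> \<Longrightarrow> a u \<theta> \<le> a u \<eta>"
    and sup: "\<And>u m. u \<in> U \<Longrightarrow> (\<And>\<theta>. finite \<theta> \<Longrightarrow> \<theta> \<subseteq> \<Lambda> \<Longrightarrow> a u \<theta> \<le> m) \<Longrightarrow> x u \<le> m"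
    and "\<And>\<theta>. finite \<theta> \<Longrightarrow> \<theta> \<subseteq> \<Lambda> \<Longrightarrow> (\<Sum>u\<in>U. a u \<theta>) \<le> m"
  shows "(\<Sum>u\<in>U. x u) \<le> m"
  using assms
proof (induction U arbitrary: m rule: finite_induct)
  case empty
  then show ?case by force
next
  case (insert u U)
  have "(\<Sum>u\<in>U. x u) \<le> m - x u"
  proof (rule insert.IH)
    fix \<theta> assume \<theta>: "finite \<theta>" "\<theta> \<subseteq> \<Lambda>"
    have "x u \<le> m - (\<Sum>u\<in>U. a u \<theta>)"
    proof (rule insert.prems(2))
      fix \<eta> assume \<eta>: "finite \<eta>" "\<eta> \<subseteq> \<Lambda>"
      have "a u \<eta> + (\<Sum>u\<in>U. a u \<theta>) \<le> a u (\<eta> \<union> \<theta>) + (\<Sum>u\<in>U. a u (\<eta> \<union> \<theta>))"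
        using \<theta> \<eta> by (intro add_mono sum_mono insert.prems(1)) auto
      also have "\<dots> \<le> m"
        using insert.prems(3)[of "\<eta> \<union> \<theta>"] \<theta> \<eta> insert.hyps by simp
      finally show "a u \<eta> \<le> m - (\<Sum>u\<in>U. a u \<theta>)" by (simp add: algebra_simps)
    qed simp
    then show "(\<Sum>u\<in>U. a u \<theta>) \<le> m - x u" by (simp add: algebra_simps)
  qed (use insert.prems in auto)
  then show ?case using insert.hyps by (simp add: algebra_simps)
qed


section \<open>The exact dominant as a supremum over disjoint fragments\<close>

text \<open>
  The positive part and the negative part of \<open>x\<close> are disjoint, and evenness permits changing the
  sign of the latter. So the values of a dominant at fragments of \<open>\<bar>x\<bar>\<close> can be compared with
  its value at \<open>x\<close>.
\<close>

lemma uryson_pos_even_abs: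
  assumes "S \<in> uryson_pos_even"
  shows "S \<bar>x\<bar> = S x"
proof -
  have oa: "\<And>x y. disjoint_elts abs x y \<Longrightarrow> S (x + y) = S x + S y" and ev: "\<And>x. S (- x) = S x"
    using assms unfolding uryson_pos_even_def abstract_uryson_def orthogonally_additive_def even_op_def
    by auto
  have "inf (pprt x) (- nprt x) = 0"
  proof -
    have "pprt x = x - nprt x" using prts[of x] by (simp add: algebra_simps)
    moreover have "inf (x - nprt x) (0 - nprt x) = inf x 0 - nprt x"
      using add_inf_distrib_right[of x 0 "- nprt x"] by simp
    ultimately show ?thesis by (simp add: nprt_def)
  qed
  then have d: "disjoint_elts abs (pprt x) (nprt x)" "disjoint_elts abs (pprt x) (- nprt x)"
    unfolding disjoint_elts_def by (simp_all add: abs_of_nonpos)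
  have "S x = S (pprt x + nprt x)" by (simp flip: prts)
  also have "\<dots> = S (pprt x + - nprt x)" using d by (simp only: oa ev)
  also have "pprt x + - nprt x = \<bar>x\<bar>" by (simp add: abs_prts)
  finally show ?thesis by simp
qed

text \<open>
  Induction on the number of fragments: after \<open>x i\<close> has been split off, the other \<open>x j\<close> are
  fragments of \<open>a - x i\<close>, and \<open>S a = S (x i) + S (a - x i)\<close>.
\<close>

lemma sum_fragments_le:
  assumes S: "orthogonally_additive abs S" "positive_op S"
    and "finite I" "\<And>i. i \<in> I \<Longrightarrow> fragment (x i) a"
    and "pairwise (\<lambda>i j. inf (x i) (x j) = 0) I"
  shows "(\<Sum>i\<in>I. S (x i)) \<le> S a"
  using assms(3-5)
proof (induction I arbitrary: a rule: finite_induct)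
  case empty
  then show ?case using S(2) by (simp add: positive_op_def)
next
  case (insert i I)
  have fi: "fragment (x i) a" using insert by simp
  have "fragment (x j) (a - x i)" if "j \<in> I" for j
    using that insert.hyps insert.prems by (intro fragment_diff fi) (auto simp: pairwise_insert)
  then have "(\<Sum>j\<in>I. S (x j)) \<le> S (a - x i)"
    using insert by (simp add: pairwise_insert)
  moreover have "disjoint_elts abs (x i) (a - x i)"
    using fi fragment_nonneg[OF fi] fragment_le[OF fi] by (simp add: disjoint_elts_def fragment_def)
  then have "S (x i + (a - x i)) = S (x i) + S (a - x i)"
    using S(1) unfolding orthogonally_additive_def by blast
  ultimately show ?case using insert by simp
qed

locale dominated_uryson_operator =
  dom: lattice_normed_space nV + cod: lattice_normed_space nW
  for nV :: "'v::real_vector \<Rightarrow> 'e::archimedean_vector_lattice"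
    and nW :: "'w::real_vector \<Rightarrow> 'f::{archimedean_vector_lattice, conditionally_complete_lattice}" +
  fixes T :: "'v \<Rightarrow> 'w"
  assumes decomposable: "decomposable nV" and dominated: "dominated_uryson nV nW T"
begin

lemma T_orthogonally_additive: "orthogonally_additive nV T"
  using dominated by (simp add: dominated_uryson_def)

lemma T_zero: "T 0 = 0"
  using dom.orthogonally_additive_zero T_orthogonally_additive by blast

definition disjoint_fragments :: "'e \<Rightarrow> 'v set set" where
  "disjoint_fragments e =
    {U. finite U \<and> pairwise (disjoint_elts nV) U \<and> (\<forall>u\<in>U. fragment (nV u) \<bar>e\<bar>)}"

definition variation :: "'e \<Rightarrow> 'f" where
  "variation e = (SUP U\<in>disjoint_fragments e. \<Sum>u\<in>U. nW (T u))"

lemma sum_le_dominant: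
  assumes S: "dominant nV nW T S" and U: "U \<in> disjoint_fragments e"
  shows "(\<Sum>u\<in>U. nW (T u)) \<le> S e"
proof -
  have S': "S \<in> uryson_pos_even" and le: "\<And>v. nW (T v) \<le> S (nV v)"
    using S unfolding dominant_def by auto
  have "(\<Sum>u\<in>U. nW (T u)) \<le> (\<Sum>u\<in>U. S (nV u))" using le by (rule sum_mono)
  also have "\<dots> \<le> S \<bar>e\<bar>"
  proof (rule sum_fragments_le[where S = S])
    show "orthogonally_additive abs S" "positive_op S"
      using S' by (simp_all add: uryson_pos_even_def abstract_uryson_def)
    show "finite U" "\<And>u. u \<in> U \<Longrightarrow> fragment (nV u) \<bar>e\<bar>"
      using U by (simp_all add: disjoint_fragments_def)
    show "pairwise (\<lambda>u v. inf (nV u) (nV v) = 0) U"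
      using U unfolding disjoint_fragments_def disjoint_elts_def[abs_def] by simp
  qed
  also have "\<dots> = S e" using S' by (rule uryson_pos_even_abs)
  finally show ?thesis .
qed

lemma disjoint_fragments_nonempty: "disjoint_fragments e \<noteq> {}"
proof -
  have "{} \<in> disjoint_fragments e" by (simp add: disjoint_fragments_def)
  then show ?thesis by blast
qed

lemma sum_le_variation:
  assumes "U \<in> disjoint_fragments e"
  shows "(\<Sum>u\<in>U. nW (T u)) \<le> variation e"
proof -
  obtain S where "dominant nV nW T S" using dominated by (auto simp: dominated_uryson_def)
  then have "bdd_above ((\<lambda>U. \<Sum>u\<in>U. nW (T u)) ` disjoint_fragments e)"
    using sum_le_dominant by (intro bdd_aboveI2) blast
  then show ?thesis unfolding variation_def using assms by (rule cSUP_upper2) simp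
qed

lemma variation_least:
  assumes "\<And>U. U \<in> disjoint_fragments e \<Longrightarrow> (\<Sum>u\<in>U. nW (T u)) \<le> m"
  shows "variation e \<le> m"
  unfolding variation_def using disjoint_fragments_nonempty assms by (rule cSUP_least)

text \<open>
  Families are more convenient than the sets in the definition, as they survive splitting every
  member. They give no larger sums: by disjointness, members with distinct indices can coincide only
  if they are \<open>0\<close>.
\<close>

lemma sum_family_le_variation:
  assumes "finite I" "pairwise (\<lambda>i j. disjoint_elts nV (u i) (u j)) I"
    and "\<And>i. i \<in> I \<Longrightarrow> fragment (nV (u i)) \<bar>e\<bar>"
  shows "(\<Sum>i\<in>I. nW (T (u i))) \<le> variation e"
proof -
  define J where "J = {i\<in>I. u i \<noteq> 0}"
  have inj: "inj_on u J"
  proof (rule inj_onI, rule ccontr)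
    fix i j assume ij: "i \<in> J" "j \<in> J" "u i = u j" "i \<noteq> j"
    then have "disjoint_elts nV (u i) (u j)" 
      using assms(2) unfolding J_def pairwise_def by blast
    then show False using ij by (simp add: dom.disjoint_elts_self J_def)
  qed
  have "(\<Sum>i\<in>I. nW (T (u i))) = (\<Sum>i\<in>J. nW (T (u i)))"
    using assms(1) T_zero by (intro sum.mono_neutral_right) (auto simp: J_def)
  also have "\<dots> = (\<Sum>x\<in>u ` J. nW (T x))" using inj by (simp add: sum.reindex)
  also have "\<dots> \<le> variation e"
  proof (rule sum_le_variation)
    have "pairwise (disjoint_elts nV) (u ` J)"
      using assms(2) unfolding pairwise_def J_def by fastforce
    then show "u ` J \<in> disjoint_fragments e"
      using assms unfolding disjoint_fragments_def J_def by auto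
  qed
  finally show ?thesis .
qed

lemma nW_T_le_variation: "nW (T v) \<le> variation (nV v)"
  using sum_le_variation[of "{v}" "nV v"]
  by (simp add: disjoint_fragments_def fragment_self dom.nrm_nonneg)

lemma variation_nonneg: "0 \<le> variation e"
  using sum_le_variation[of "{}" e] by (simp add: disjoint_fragments_def)

text \<open>
  Decomposability enters here: every \<open>u\<close> splits into a part \<open>p u\<close> of norm \<open>inf (nV u) \<bar>e\<bar>\<close> and a
  disjoint part \<open>q u\<close> of norm \<open>inf (nV u) \<bar>f\<bar>\<close>.
\<close>

lemma variation_add_le:
  assumes "disjoint_elts abs e f"
  shows "variation (e + f) \<le> variation e + variation f"
proof (rule variation_least)
  fix U assume U: "U \<in> disjoint_fragments (e + f)"
  have d: "inf \<bar>e\<bar> \<bar>f\<bar> = 0" using assms by (simp add: disjoint_elts_def)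
  have ef: "\<bar>e + f\<bar> = \<bar>e\<bar> + \<bar>f\<bar>" by (rule abs.nrm_add_disjoint[OF assms])
  have fin: "finite U" and disj: "pairwise (disjoint_elts nV) U"
    and frag: "\<And>u. u \<in> U \<Longrightarrow> fragment (nV u) (\<bar>e\<bar> + \<bar>f\<bar>)"
    using U unfolding disjoint_fragments_def ef by auto
  have "\<exists>u1 u2. u = u1 + u2 \<and> nV u1 = inf (nV u) \<bar>e\<bar> \<and> nV u2 = inf (nV u) \<bar>f\<bar> \<and>
      disjoint_elts nV u1 u2" if "u \<in> U" for u
    using dom.fragment_decomposition[OF decomposable frag[OF that] d] by metis
  then obtain p q where pq: "\<And>u. u \<in> U \<Longrightarrow> u = p u + q u"
      "\<And>u. u \<in> U \<Longrightarrow> nV (p u) = inf (nV u) \<bar>e\<bar>" "\<And>u. u \<in> U \<Longrightarrow> nV (q u) = inf (nV u) \<bar>f\<bar>"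
      "\<And>u. u \<in> U \<Longrightarrow> disjoint_elts nV (p u) (q u)"
    by metis
  have disj_inf: "disjoint_elts nV x y"
    if "nV x = inf (nV u) a" "nV y = inf (nV v) a" "disjoint_elts nV u v" "0 \<le> a" for x y u v a
    using that inf_eq_0_mono[of "nV u" "nV v" "inf (nV u) a" "inf (nV v) a"]
    by (simp add: disjoint_elts_def dom.nrm_nonneg)
  have "nW (T u) \<le> nW (T (p u)) + nW (T (q u))" if "u \<in> U" for u
  proof -
    have "T u = T (p u) + T (q u)"
      using pq that T_orthogonally_additive unfolding orthogonally_additive_def by metis
    then show ?thesis using cod.nrm_triangle by simp
  qed
  then have "(\<Sum>u\<in>U. nW (T u)) \<le> (\<Sum>u\<in>U. nW (T (p u))) + (\<Sum>u\<in>U. nW (T (q u)))"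
    unfolding sum.distrib[symmetric] by (rule sum_mono)
  also have "\<dots> \<le> variation e + variation f"
  proof (intro add_mono sum_family_le_variation fin)
    show "pairwise (\<lambda>u v. disjoint_elts nV (p u) (p v)) U"
      using disj pq(2) disj_inf abs_ge_zero unfolding pairwise_def by meson
    show "pairwise (\<lambda>u v. disjoint_elts nV (q u) (q v)) U"
      using disj pq(3) disj_inf abs_ge_zero unfolding pairwise_def by meson
    show "fragment (nV (p u)) \<bar>e\<bar>" if "u \<in> U" for u
      unfolding pq(2)[OF that] using frag[OF that] by (rule fragment_inf) auto
    show "fragment (nV (q u)) \<bar>f\<bar>" if "u \<in> U" for u
      unfolding pq(3)[OF that] using frag[OF that]
      by (intro fragment_inf[of _ _ "\<bar>e\<bar>"]) (auto simp: add.commute)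
  qed
  finally show "(\<Sum>u\<in>U. nW (T u)) \<le> variation e + variation f" .
qed

text \<open>
  A set for \<open>e\<close> and a set for \<open>f\<close> unite to a set for \<open>e + f\<close>; they have at most \<open>0\<close> in common.
\<close>

lemma variation_add_ge:
  assumes "disjoint_elts abs e f"
  shows "variation e + variation f \<le> variation (e + f)"
proof -
  have d: "inf \<bar>e\<bar> \<bar>f\<bar> = 0" using assms by (simp add: disjoint_elts_def)
  have ef: "\<bar>e + f\<bar> = \<bar>e\<bar> + \<bar>f\<bar>" by (rule abs.nrm_add_disjoint[OF assms])
  have *: "(\<Sum>u\<in>U. nW (T u)) + (\<Sum>v\<in>V. nW (T v)) \<le> variation (e + f)"
    if U: "U \<in> disjoint_fragments e" and V: "V \<in> disjoint_fragments f" for U V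
  proof -
    have fU: "fragment (nV u) \<bar>e\<bar>" if "u \<in> U" for u using that U by (simp add: disjoint_fragments_def)
    have fV: "fragment (nV v) \<bar>f\<bar>" if "v \<in> V" for v using that V by (simp add: disjoint_fragments_def)
    have UV: "disjoint_elts nV u v" if "u \<in> U" "v \<in> V" for u v
      unfolding disjoint_elts_def using fU[OF that(1)] fV[OF that(2)]
      by (intro inf_eq_0_mono[OF d] fragment_nonneg fragment_le)
    have fin: "finite U" "finite V" using U V by (simp_all add: disjoint_fragments_def)
    have "u = 0" if "u \<in> U \<inter> V" for u
      using UV[of u u] that by (simp add: dom.disjoint_elts_self)
    then have "(\<Sum>u\<in>U \<inter> V. nW (T u)) = 0"
      using T_zero by (intro sum.neutral) fastforce
    then have "(\<Sum>u\<in>U. nW (T u)) + (\<Sum>v\<in>V. nW (T v)) = (\<Sum>u\<in>U \<union> V. nW (T u))"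
      using fin by (simp flip: sum.union_inter)
    also have "\<dots> \<le> variation (e + f)"
    proof (rule sum_le_variation)
      have "pairwise (disjoint_elts nV) (U \<union> V)"
      proof (rule pairwiseI)
        have dU: "pairwise (disjoint_elts nV) U" "pairwise (disjoint_elts nV) V"
          using U V by (simp_all add: disjoint_fragments_def)
        have VU: "disjoint_elts nV v u" if "u \<in> U" "v \<in> V" for u v
          using UV[OF that] by (simp add: dom.disjoint_elts_commute)
        fix x y assume "x \<in> U \<union> V" "y \<in> U \<union> V" "x \<noteq> y"
        then show "disjoint_elts nV x y"
          by (elim UnE) (simp_all add: pairwiseD[OF dU(1)] pairwiseD[OF dU(2)] UV VU)
      qed
      moreover have "fragment (nV u) (\<bar>e\<bar> + \<bar>f\<bar>)" if "u \<in> U \<union> V" for u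
        using that fU fV fragment_add[OF _ d] fragment_add[of _ "\<bar>f\<bar>" "\<bar>e\<bar>"] d
        by (auto simp: inf_commute add.commute)
      ultimately show "U \<union> V \<in> disjoint_fragments (e + f)"
        using fin by (simp add: disjoint_fragments_def ef)
    qed
    finally show ?thesis .
  qed
  have "variation f \<le> variation (e + f) - (\<Sum>u\<in>U. nW (T u))" if "U \<in> disjoint_fragments e" for U
    using *[OF that] by (intro variation_least) (simp add: algebra_simps)
  then have "variation e \<le> variation (e + f) - variation f"
    by (intro variation_least) (simp add: algebra_simps)
  then show ?thesis by (simp add: algebra_simps)
qed

lemma variation_orthogonally_additive: "orthogonally_additive abs variation"
  unfolding orthogonally_additive_def
  by (intro allI impI order.antisym variation_add_le variation_add_ge)

lemma variation_le_dominant: "dominant nV nW T S \<Longrightarrow> variation e \<le> S e"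
  by (intro variation_least sum_le_dominant)

lemma variation_dominant: "dominant nV nW T variation"
proof -
  obtain S where S: "dominant nV nW T S" using dominated by (auto simp: dominated_uryson_def)
  have "order_bounded_op variation"
    unfolding order_bounded_op_def
  proof (intro allI impI)
    fix A :: "'e set" assume "order_bounded_set A"
    then have "order_bounded_set (S ` A)"
      using S unfolding dominant_def uryson_pos_even_def abstract_uryson_def order_bounded_op_def
      by blast
    then obtain c d where "S ` A \<subseteq> {c..d}" unfolding order_bounded_set_def by blast
    then have Sd: "S e \<le> d" if "e \<in> A" for e using that by auto
    have "variation e \<le> d" if "e \<in> A" for e
      using variation_le_dominant[OF S] Sd[OF that] by (rule order_trans)
    then show "order_bounded_set (variation ` A)"
      unfolding order_bounded_set_def using variation_nonneg
      by (intro exI[of _ 0] exI[of _ d]) auto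
  qed
  moreover have "even_op variation"
    by (simp add: even_op_def variation_def disjoint_fragments_def)
  ultimately show ?thesis
    using variation_orthogonally_additive variation_nonneg nW_T_le_variation
    by (simp add: dominant_def uryson_pos_even_def abstract_uryson_def positive_op_def)
qed

lemma exact_dominant_eq_variation: "exact_dominant nV nW T = variation"
  unfolding exact_dominant_def
proof (rule the_equality)
  show "dominant nV nW T variation \<and> (\<forall>S'. dominant nV nW T S' \<longrightarrow> op_le variation S')"
    using variation_dominant variation_le_dominant by (simp add: op_le_def positive_op_def)
  fix S assume "dominant nV nW T S \<and> (\<forall>S'. dominant nV nW T S' \<longrightarrow> op_le S S')"
  then have "S e \<le> variation e" "variation e \<le> S e" for e
    using variation_dominant variation_le_dominant by (auto simp: op_le_def positive_op_def)
  then show "S = variation" by (intro ext order.antisym)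
qed


section \<open>Complete additivity\<close>

text \<open>
  The remainder of the series of the \<open>T (v \<alpha>)\<close> is \<open>T\<close> of a remainder, and its norm is at most the
  remainder of the series of the \<open>variation (nV (v \<alpha>))\<close>, term by term in the net.
\<close>

lemma completely_additive_if_variation:
  assumes "completely_additive abs abs variation"
  shows "completely_additive nV nW T"
  unfolding completely_additive_def
proof (intro conjI T_orthogonally_additive allI impI)
  fix \<Lambda> :: "'v set" and v s
  assume "\<forall>\<alpha>\<in>\<Lambda>. \<forall>\<beta>\<in>\<Lambda>. \<alpha> \<noteq> \<beta> \<longrightarrow> disjoint_elts nV (v \<alpha>) (v \<beta>)"
    and sum: "has_bo_sum nV \<Lambda> v s"
  then have disj: "pairwise (\<lambda>\<alpha> \<beta>. disjoint_elts nV (v \<alpha>) (v \<beta>)) \<Lambda>"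
    by (simp add: pairwise_def)
  have "has_bo_sum abs \<Lambda> (\<lambda>\<alpha>. variation (nV (v \<alpha>))) (variation (nV s))"
    using assms
  proof (rule abs.completely_additiveD)
    show "has_bo_sum abs \<Lambda> (\<lambda>\<alpha>. nV (v \<alpha>)) (nV s)" using sum disj by (rule dom.has_bo_sum_nrm)
    show "disjoint_elts abs (nV (v \<alpha>)) (nV (v \<beta>))" if "\<alpha> \<in> \<Lambda>" "\<beta> \<in> \<Lambda>" "\<alpha> \<noteq> \<beta>" for \<alpha> \<beta>
      using that disj by (simp add: pairwise_def disjoint_elts_def dom.nrm_nonneg)
  qed
  then show "has_bo_sum nW \<Lambda> (\<lambda>\<alpha>. T (v \<alpha>)) (T s)"
  proof (rule abs.has_bo_sumI_nrm_le)
    fix \<theta> assume \<theta>: "finite \<theta>" "\<theta> \<subseteq> \<Lambda>"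
    let ?w = "\<Sum>\<alpha>\<in>\<theta>. v \<alpha>"
    have disj\<theta>: "pairwise (\<lambda>\<alpha> \<beta>. disjoint_elts nV (v \<alpha>) (v \<beta>)) \<theta>"
      using disj \<theta>(2) by (rule pairwise_subset)
    have d: "disjoint_elts nV ?w (s - ?w)"
      using disj sum \<theta> by (rule dom.has_bo_sum_remainder_disjoint)
    have "T (?w + (s - ?w)) = T ?w + T (s - ?w)"
      using T_orthogonally_additive d unfolding orthogonally_additive_def by blast
    then have T: "T s - (\<Sum>\<alpha>\<in>\<theta>. T (v \<alpha>)) = T (s - ?w)"
      using dom.orthogonally_additive_sum[OF T_orthogonally_additive \<theta>(1) disj\<theta>] by simp
    have "disjoint_elts abs (nV ?w) (nV (s - ?w))"
      using d by (simp add: disjoint_elts_def dom.nrm_nonneg)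
    then have "variation (nV ?w + nV (s - ?w)) = variation (nV ?w) + variation (nV (s - ?w))"
      using variation_orthogonally_additive unfolding orthogonally_additive_def by blast
    moreover have "nV ?w + nV (s - ?w) = nV s"
      using dom.nrm_add_disjoint[OF d] by simp
    moreover have "variation (nV ?w) = (\<Sum>\<alpha>\<in>\<theta>. variation (nV (v \<alpha>)))"
      using dom.orthogonally_additive_sum[OF dom.orthogonally_additive_nrm \<theta>(1) disj\<theta>]
        abs.orthogonally_additive_sum[OF variation_orthogonally_additive \<theta>(1), of "\<lambda>\<alpha>. nV (v \<alpha>)"] disj\<theta>
      by (simp add: disjoint_elts_def dom.nrm_nonneg)
    ultimately have N: "variation (nV s) - (\<Sum>\<alpha>\<in>\<theta>. variation (nV (v \<alpha>))) = variation (nV (s - ?w))"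
      by simp
    show "nW (T s - (\<Sum>\<alpha>\<in>\<theta>. T (v \<alpha>))) \<le>
        \<bar>variation (nV s) - (\<Sum>\<alpha>\<in>\<theta>. variation (nV (v \<alpha>)))\<bar>"
      unfolding T N using nW_T_le_variation abs_ge_self order_trans by blast
  qed
qed

text \<open>
  The sums of the \<open>variation (e \<alpha>)\<close> are compared with sums over rectangles: the component
  \<open>c u \<alpha>\<close> is the part of \<open>u \<in> U\<close> below \<open>\<bar>e \<alpha>\<bar>\<close>. Summing the \<open>nW (T (c u \<alpha>))\<close> over \<open>u\<close> is bounded by
  \<open>variation (e \<alpha>)\<close>, while summing over \<open>\<alpha>\<close> approximates at least \<open>nW (T u)\<close>, by complete
  additivity of \<open>T\<close>.
\<close>

lemma variation_le_of_sums:
  assumes ca: "completely_additive nV nW T"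
    and disj: "pairwise (\<lambda>\<alpha> \<beta>. disjoint_elts abs (e \<alpha>) (e \<beta>)) \<Lambda>"
    and sum: "has_bo_sum abs \<Lambda> e s"
    and m: "\<And>\<theta>. finite \<theta> \<Longrightarrow> \<theta> \<subseteq> \<Lambda> \<Longrightarrow> (\<Sum>\<alpha>\<in>\<theta>. variation (e \<alpha>)) \<le> m"
  shows "variation s \<le> m"
proof (rule variation_least)
  fix U assume "U \<in> disjoint_fragments s"
  then have fin: "finite U" and disjU: "pairwise (disjoint_elts nV) U"
    and frag: "\<And>u. u \<in> U \<Longrightarrow> fragment (nV u) \<bar>s\<bar>"
    by (auto simp: disjoint_fragments_def)
  have sa: "inf \<bar>e \<alpha>\<bar> \<bar>s - e \<alpha>\<bar> = 0" "\<bar>s\<bar> = \<bar>e \<alpha>\<bar> + \<bar>s - e \<alpha>\<bar>" if "\<alpha> \<in> \<Lambda>" for \<alpha>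
  proof -
    have d: "disjoint_elts abs (e \<alpha>) (s - e \<alpha>)"
      using abs.has_bo_sum_remainder_disjoint[OF disj sum, of "{\<alpha>}"] that by simp
    show "inf \<bar>e \<alpha>\<bar> \<bar>s - e \<alpha>\<bar> = 0" using d by (simp add: disjoint_elts_def)
    show "\<bar>s\<bar> = \<bar>e \<alpha>\<bar> + \<bar>s - e \<alpha>\<bar>" using abs.nrm_add_disjoint[OF d] by simp
  qed
  have "\<exists>c. nV c = inf (nV u) \<bar>e \<alpha>\<bar> \<and> disjoint_elts nV c (u - c)" if "u \<in> U" "\<alpha> \<in> \<Lambda>" for u \<alpha>
  proof -
    have "fragment (nV u) (\<bar>e \<alpha>\<bar> + \<bar>s - e \<alpha>\<bar>)" using frag[OF that(1)] sa(2)[OF that(2)] by simp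
    from dom.fragment_decomposition[OF decomposable this sa(1)[OF that(2)]]
    show ?thesis by (metis add_diff_cancel_left')
  qed
  then obtain c where c: "\<And>u \<alpha>. u \<in> U \<Longrightarrow> \<alpha> \<in> \<Lambda> \<Longrightarrow> nV (c u \<alpha>) = inf (nV u) \<bar>e \<alpha>\<bar>"
    "\<And>u \<alpha>. u \<in> U \<Longrightarrow> \<alpha> \<in> \<Lambda> \<Longrightarrow> disjoint_elts nV (c u \<alpha>) (u - c u \<alpha>)"
    by metis
  show "(\<Sum>u\<in>U. nW (T u)) \<le> m"
  proof (rule sum_of_suprema_le[OF fin, where a = "\<lambda>u \<theta>. \<Sum>\<alpha>\<in>\<theta>. nW (T (c u \<alpha>))" and \<Lambda> = \<Lambda>])
    show "(\<Sum>\<alpha>\<in>\<theta>. nW (T (c u \<alpha>))) \<le> (\<Sum>\<alpha>\<in>\<eta>. nW (T (c u \<alpha>)))"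
      if "finite \<eta>" "\<theta> \<subseteq> \<eta>" for u \<theta> \<eta>
      using that by (intro sum_mono2) (auto simp: cod.nrm_nonneg)
  next
    fix u m' assume u: "u \<in> U"
      and m': "\<And>\<theta>. finite \<theta> \<Longrightarrow> \<theta> \<subseteq> \<Lambda> \<Longrightarrow> (\<Sum>\<alpha>\<in>\<theta>. nW (T (c u \<alpha>))) \<le> m'"
    note comp = dom.bo_sum_of_components[OF disj sum fragment_le[OF frag[OF u]] c(1)[OF u] c(2)[OF u]]
    have "has_bo_sum nW \<Lambda> (\<lambda>\<alpha>. T (c u \<alpha>)) (T u)"
      using ca _ comp(1) by (rule dom.completely_additiveD) (use comp(2) in \<open>auto simp: pairwise_def\<close>)
    then show "nW (T u) \<le> m'"
    proof (rule cod.has_bo_sum_nrm_le[where a = "{}"])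
      fix \<theta> assume \<theta>: "finite \<theta>" "\<theta> \<subseteq> \<Lambda>"
      let ?t = "\<Sum>\<alpha>\<in>\<theta>. T (c u \<alpha>)"
      have "nW (T u) \<le> nW (T u - ?t) + nW ?t"
        using cod.nrm_triangle[of "T u - ?t" ?t] by simp
      also have "nW ?t \<le> m'"
        using cod.nrm_sum_le m'[OF \<theta>] by (rule order_trans)
      finally show "nW (T u) \<le> nW (T u - ?t) + m'" by simp
    qed auto
  next
    fix \<theta> assume \<theta>: "finite \<theta>" "\<theta> \<subseteq> \<Lambda>"
    have "(\<Sum>u\<in>U. nW (T (c u \<alpha>))) \<le> variation (e \<alpha>)" if "\<alpha> \<in> \<theta>" for \<alpha>
    proof (rule sum_family_le_variation[OF fin])
      have \<alpha>: "\<alpha> \<in> \<Lambda>" using that \<theta> by auto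
      show "pairwise (\<lambda>u v. disjoint_elts nV (c u \<alpha>) (c v \<alpha>)) U"
      proof (rule pairwiseI)
        fix u v assume "u \<in> U" "v \<in> U" "u \<noteq> v"
        then show "disjoint_elts nV (c u \<alpha>) (c v \<alpha>)"
          using disjU c(1) \<alpha> inf_eq_0_mono[of "nV u" "nV v" "inf (nV u) \<bar>e \<alpha>\<bar>" "inf (nV v) \<bar>e \<alpha>\<bar>"]
          by (simp add: disjoint_elts_def pairwise_def dom.nrm_nonneg)
      qed
      show "fragment (nV (c u \<alpha>)) \<bar>e \<alpha>\<bar>" if "u \<in> U" for u
        using frag[OF that] sa(2)[OF \<alpha>] c(1)[OF that \<alpha>] fragment_inf[of "nV u" "\<bar>e \<alpha>\<bar>" "\<bar>s - e \<alpha>\<bar>"]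
        by simp
    qed
    then have "(\<Sum>\<alpha>\<in>\<theta>. \<Sum>u\<in>U. nW (T (c u \<alpha>))) \<le> (\<Sum>\<alpha>\<in>\<theta>. variation (e \<alpha>))"
      by (rule sum_mono)
    also have "\<dots> \<le> m" using m \<theta> by simp
    finally show "(\<Sum>u\<in>U. \<Sum>\<alpha>\<in>\<theta>. nW (T (c u \<alpha>))) \<le> m"
      by (subst sum.swap)
  qed
qed

text \<open>
  The net of the remainders \<open>g \<theta>\<close> serves as its own dominating net: it decreases, it is positive
  since \<open>g \<theta>\<close> is the value of \<^const>\<open>variation\<close> at the remainder of the series, and its infimum is
  \<open>0\<close> by the preceding lemma.
\<close>

lemma variation_completely_additive:
  assumes "completely_additive nV nW T"
  shows "completely_additive abs abs variation"
  unfolding completely_additive_def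
proof (intro conjI variation_orthogonally_additive allI impI)
  fix \<Lambda> :: "'e set" and e :: "'e \<Rightarrow> 'e" and s
  assume "\<forall>\<alpha>\<in>\<Lambda>. \<forall>\<beta>\<in>\<Lambda>. \<alpha> \<noteq> \<beta> \<longrightarrow> disjoint_elts abs (e \<alpha>) (e \<beta>)"
    and sum: "has_bo_sum abs \<Lambda> e s"
  then have disj: "pairwise (\<lambda>\<alpha> \<beta>. disjoint_elts abs (e \<alpha>) (e \<beta>)) \<Lambda>"
    by (simp add: pairwise_def)
  let ?F = "{\<theta>. finite \<theta> \<and> \<theta> \<subseteq> \<Lambda>}"
  define g where "g = (\<lambda>\<theta>. variation s - (\<Sum>\<alpha>\<in>\<theta>. variation (e \<alpha>)))"
  have g_nonneg: "0 \<le> g \<theta>" if "\<theta> \<in> ?F" for \<theta>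
  proof -
    have \<theta>: "finite \<theta>" "\<theta> \<subseteq> \<Lambda>" using that by auto
    let ?w = "\<Sum>\<alpha>\<in>\<theta>. e \<alpha>"
    have "variation (?w + (s - ?w)) = variation ?w + variation (s - ?w)"
      using abs.has_bo_sum_remainder_disjoint[OF disj sum \<theta>] variation_orthogonally_additive
      unfolding orthogonally_additive_def by blast
    moreover have "variation ?w = (\<Sum>\<alpha>\<in>\<theta>. variation (e \<alpha>))"
      using variation_orthogonally_additive \<theta>(1) pairwise_subset[OF disj \<theta>(2)]
      by (rule abs.orthogonally_additive_sum)
    ultimately show ?thesis using variation_nonneg by (simp add: g_def)
  qed
  have g_mono: "g \<eta> \<le> g \<theta>" if "\<eta> \<in> ?F" "\<theta> \<subseteq> \<eta>" for \<theta> \<eta>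
    unfolding g_def using that by (intro diff_left_mono sum_mono2) (auto simp: variation_nonneg)
  have "decreasing_to_0 ?F (\<subseteq>) g"
    unfolding decreasing_to_0_def isGlb_UNIV_iff
  proof (intro conjI allI impI)
    show "directed_set ?F (\<subseteq>)"
      unfolding directed_set_def
    proof (intro conjI ballI)
      fix a b assume "a \<in> ?F" "b \<in> ?F"
      then show "\<exists>c\<in>?F. a \<subseteq> c \<and> b \<subseteq> c" by (intro bexI[of _ "a \<union> b"]) auto
    qed (auto intro!: reflp_onI transp_onI)
    fix l assume l: "\<forall>y\<in>g ` ?F. l \<le> y"
    have "variation s \<le> variation s - l"
      using assms disj sum
    proof (rule variation_le_of_sums)
      fix \<theta> assume "finite \<theta>" "\<theta> \<subseteq> \<Lambda>"
      then have "l \<le> g \<theta>" using l by simp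
      then show "(\<Sum>\<alpha>\<in>\<theta>. variation (e \<alpha>)) \<le> variation s - l" by (simp add: g_def algebra_simps)
    qed
    then show "l \<le> 0" by simp
  qed (use g_nonneg g_mono in auto)
  then show "has_bo_sum abs \<Lambda> (\<lambda>\<alpha>. variation (e \<alpha>)) (variation s)"
    unfolding has_bo_sum_def
  proof (rule bo_converges_toI)
    fix \<theta> assume \<theta>: "\<theta> \<in> ?F"
    have "\<bar>variation s - (\<Sum>\<alpha>\<in>\<eta>. variation (e \<alpha>))\<bar> \<le> g \<theta>" if "\<eta> \<in> ?F" "\<theta> \<subseteq> \<eta>" for \<eta>
      using g_mono[OF that] g_nonneg[OF that(1)] by (simp add: g_def)
    then show "\<exists>a\<in>?F. \<forall>b\<in>?F. a \<subseteq> b \<longrightarrow> \<bar>variation s - (\<Sum>\<alpha>\<in>b. variation (e \<alpha>))\<bar> \<le> g \<theta>"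
      using \<theta> by blast
  qed
qed

end

theorem theorem6p5:
  fixes nV :: "'v::real_vector \<Rightarrow> 'e::archimedean_vector_lattice"
    and nW :: "'w::real_vector \<Rightarrow> 'f::{archimedean_vector_lattice, conditionally_complete_lattice}"
    and T :: "'v \<Rightarrow> 'w"
  assumes "lattice_normed_space nV" and "decomposable nV"
    and "banach_kantorovich_space nW"
    and "dominated_uryson nV nW T"
  shows "completely_additive nV nW T \<longleftrightarrow>
    completely_additive abs abs (exact_dominant nV nW T)"
proof -
  interpret dominated_uryson_operator nV nW T
    using assms by (simp add: dominated_uryson_operator_def dominated_uryson_operator_axioms_def
      banach_kantorovich_space_def)
  show ?thesis
    unfolding exact_dominant_eq_variation
    using completely_additive_if_variation variation_completely_additive by blast
qed

end
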